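(* Let $\Omega$ be a domain in $\mathbb C^n$ containing the origin $0$, let $t>-n$ be a real number, and let $\varphi$ be a plurisubharmonic function on $\Omega$. Then $\nu_\varphi(0)\in(0,+\infty)$ if and only if $c_t(\varphi)\in(0,+\infty)$. Moreover, if $\nu_\varphi(0)>0$, then $$\frac{1}{\nu_{\varphi+\frac{|t|-t}{c_t(\varphi)}\log\|z\|}(0)}\le c_t(\varphi)\le \frac{t+n}{\nu_\varphi(0)}.$$
   Context: Plurisubharmonic functions are assumed not identically $-\infty$. $\|z\|$ is the Euclidean norm on $\mathbb C^n$. For a plurisubharmonic function $\varphi$ near $0$, the Lelong number is $\nu_\varphi(0):=\liminf_{z\to0}\frac{\varphi(z)}{\log\|z\|}$ (the notation $\nu_{\psi}(0)$ with $\psi=\varphi+\frac{|t|-t}{c_t(\varphi)}\log\|z\|$ means the Lelong number of that function $\psi$). For real $t>-n$, the weighted log canonical threshold is $c_t(\varphi):=\sup\{c\ge0:\ \|z\|^{2t}e^{-2c\varphi}\text{ is integrable (Lebesgue measure) in some neighborhood of }0\}\in[0,+\infty]$. *)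

theory Defs
  imports "HOL-Analysis.Analysis"
begin

definition upper_semicontinuous_on :: "'a::topological_space set \<Rightarrow> ('a \<Rightarrow> ereal) \<Rightarrow> bool" where
  "upper_semicontinuous_on S f \<longleftrightarrow>
     (\<forall>x\<in>S. \<forall>c. f x < c \<longrightarrow> (\<forall>\<^sub>F y in at x within S. f y < c))"

(* Mean value over a circle, computed as positive part minus negative part with value in
   the extended reals (e2ennreal truncates negative values to 0). For an upper
   semicontinuous function with values below \<infinity>, the positive part is bounded on the circle, so
   \<infinity> - \<infinity> does not occur and the mean is a real number or -\<infinity>. *)
definition circle_mean :: "(complex \<Rightarrow> ereal) \<Rightarrow> complex \<Rightarrow> real \<Rightarrow> ereal" where
  "circle_mean u a r =
     (enn2ereal (\<integral>\<^sup>+\<theta>\<in>{0..2*pi}. e2ennreal (u (a + of_real r * cis \<theta>)) \<partial>lborel)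
      - enn2ereal (\<integral>\<^sup>+\<theta>\<in>{0..2*pi}. e2ennreal (- u (a + of_real r * cis \<theta>)) \<partial>lborel))
     / ereal (2*pi)"

(* Subharmonic functions on an open subset of the plane; identically -\<infinity> is allowed here, since
   it occurs as the restriction of a plurisubharmonic function to a complex line. *)
definition subharmonic_on :: "complex set \<Rightarrow> (complex \<Rightarrow> ereal) \<Rightarrow> bool" where
  "subharmonic_on U u \<longleftrightarrow>
     (\<forall>z\<in>U. u z < \<infinity>) \<and> upper_semicontinuous_on U u \<and>
     (\<forall>a r. r > 0 \<and> cball a r \<subseteq> U \<longrightarrow> u a \<le> circle_mean u a r)"

definition plurisubharmonic_on :: "(complex^'n) set \<Rightarrow> (complex^'n \<Rightarrow> ereal) \<Rightarrow> bool" where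
  "plurisubharmonic_on \<Omega> \<phi> \<longleftrightarrow>
     (\<forall>z\<in>\<Omega>. \<phi> z < \<infinity>) \<and> upper_semicontinuous_on \<Omega> \<phi> \<and>
     (\<forall>a w. subharmonic_on {\<zeta>. a + \<zeta> *s w \<in> \<Omega>} (\<lambda>\<zeta>. \<phi> (a + \<zeta> *s w))) \<and>
     (\<exists>z\<in>\<Omega>. \<phi> z \<noteq> -\<infinity>)"

definition log_norm :: "complex^'n \<Rightarrow> ereal" where
  "log_norm z = (if z = 0 then -\<infinity> else ereal (ln (norm z)))"

definition lelong_number :: "(complex^'n \<Rightarrow> ereal) \<Rightarrow> ereal" where
  "lelong_number \<phi> = Liminf (at 0) (\<lambda>z. \<phi> z / log_norm z)"

definition exp_ereal :: "ereal \<Rightarrow> ennreal" where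
  "exp_ereal x = (case x of ereal r \<Rightarrow> ennreal (exp r) | PInfty \<Rightarrow> \<infinity> | MInfty \<Rightarrow> 0)"

(* The integrand is extended-valued: it is \<infinity> where \<phi> = -\<infinity> and c > 0. For c = 0 the convention
   0 * \<infinity> = 0 makes the factor exp 0 = 1. A function of the form
   considered here is Borel near 0, so integrability means that its integral is finite; the
   domain of \<phi> need not be mentioned because U can be shrunk. *)
definition weighted_integrable_near_0 ::
  "real \<Rightarrow> (complex^'n \<Rightarrow> ereal) \<Rightarrow> real \<Rightarrow> bool" where
  "weighted_integrable_near_0 t \<phi> c \<longleftrightarrow>
     (\<exists>U. open U \<and> 0 \<in> U \<and>
        (\<integral>\<^sup>+z\<in>U. (ennreal (norm z powr (2*t)) * exp_ereal (- (ereal (2*c) * \<phi> z))) \<partial>lborel) < \<infinity>)"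

(* For t > - n the set contains c = 0, so the supremum lies in [0, \<infinity>]. *)
definition weighted_lct :: "real \<Rightarrow> (complex^'n \<Rightarrow> ereal) \<Rightarrow> ereal" where
  "weighted_lct t \<phi> = Sup (ereal ` {c. c \<ge> 0 \<and> weighted_integrable_near_0 t \<phi> c})"

end

theory Submission
  imports Defs "HOL-Complex_Analysis.Cauchy_Integral_Formula"
begin

text \<open>
  Write \<open>n\<close> for the dimension, \<open>\<nu>\<close> for the Lelong number of \<open>\<phi>\<close> at \<open>0\<close> and \<open>c\<^sub>t\<close> for the
  weighted threshold.

  The upper bound is a comparison with a power of the norm. For \<open>0 < \<nu>' < \<nu>\<close> one has \<open>\<phi> \<le> \<nu>' log
  \<parallel>z\<parallel>\<close> near \<open>0\<close>, so that integrability of the weighted exponential with parameter \<open>c\<close> forces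
  integrability of \<open>\<parallel>z\<parallel>\<close> to the power \<open>2t - 2c\<nu>'\<close>, hence \<open>c \<nu>' \<le> t + n\<close> (lemma
  \<open>weighted_lct_le\<close>).

  The lower bound rests on Skoda's theorem: if \<open>c \<nu> < 1\<close>, then \<open>exp (- 2 c \<phi>)\<close> is integrable
  near \<open>0\<close> (lemma \<open>skoda_integrability\<close>). Young's inequality separates the weight from the
  exponential and turns this into \<open>c\<^sub>t \<ge> min 1 (1 + t/n) / \<nu>\<close> (lemma \<open>weighted_lct_ge\<close>). As \<open>n \<ge>
  1\<close>, for finite positive \<open>\<nu>\<close> this gives \<open>c\<^sub>t \<nu> \<ge> 1 - (\<bar>t\<bar> - t)\<close>, which is the left inequality
  of the theorem, because adding \<open>a log \<parallel>z\<parallel>\<close> to \<open>\<phi>\<close> raises the Lelong number by at least \<open>a\<close>.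
  The two bounds together also give the equivalence of \<open>\<nu> \<in> (0, \<infinity>)\<close> and \<open>c\<^sub>t \<in> (0, \<infinity>)\<close>: they
  make \<open>c\<^sub>t\<close> infinite when \<open>\<nu> \<le> 0\<close>, and zero when \<open>\<nu> = \<infinity>\<close>.

  Skoda's theorem is reduced to one complex variable by slicing with the complex lines through a
  point \<open>p\<close> near \<open>0\<close> at which \<open>\<phi> p > \<nu>\<^sub>1 log \<parallel>p\<parallel>\<close>, where \<open>\<nu> < \<nu>\<^sub>1 < 1/c\<close>. Such points exist
  arbitrarily close to \<open>0\<close> by the definition of the Lelong number. On each of these lines \<open>\<phi>\<close> is
  bounded above by a constant \<open>M\<close> on a disc of fixed radius \<open>R\<close>, and its value at the centre is
  not very negative. In potential-theoretic language, Jensen's formula bounds the Riesz mass in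
  a disc of radius comparable with \<open>\<parallel>p\<parallel>\<close> by about \<open>(M - \<nu>\<^sub>1 log \<parallel>p\<parallel>) / log (R / \<parallel>p\<parallel>)\<close>, which
  tends to \<open>\<nu>\<^sub>1 < 1/c\<close> as \<open>p\<close> tends to \<open>0\<close>. So the exponential is integrable on the discs,
  uniformly in the line.

  The one-variable estimate is obtained without Riesz measures, from the maximum principle. If
  \<open>u \<le> M - s\<close> on a compact subset \<open>K\<close> of the unit disc, then \<open>u - M\<close> lies below a negative
  multiple of the logarithmic potential of the normalised area measure on \<open>K\<close>, shifted by a
  constant. That potential is at most \<open>log (1 / area K) / 2 + const\<close>, so a lower bound on \<open>u 0\<close>
  forces the area of \<open>K\<close> to decay exponentially in \<open>s\<close>, with the sharp rate (lemma
  \<open>subharmonic_sublevel_area_le\<close>).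
\<close>

section \<open>Distribution functions and complex slices\<close>

text \<open>
  A weak-type bound with exponent larger than one gives integrability, by summing over the
  dyadic levels of the function. This form is used for the exponentials of subharmonic functions
  as well as for powers of the norm; the bound is explicit so that it can be applied uniformly
  to a family of slices.
\<close>
lemma nn_integral_weak_type_le:
  fixes f :: "'a \<Rightarrow> ennreal"
  assumes f [measurable]: "f \<in> borel_measurable M" and E [measurable]: "E \<in> sets M"
    and q: "q > 1" and B: "B \<ge> 0"
    and weak: "\<And>k::nat. emeasure M {x\<in>E. ennreal (2 ^ k) < f x} \<le> ennreal (B * (2 ^ k) powr (- q))"
  shows "(\<integral>\<^sup>+x\<in>E. f x \<partial>M) \<le> emeasure M E + ennreal (B / (1 - 2 powr (1 - q)))"
proof -
  let ?L = "\<lambda>k. {x\<in>E. ennreal (2 ^ k) < f x}"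
  have L [measurable]: "?L k \<in> sets M" for k :: nat
  proof -
    have "?L k = E \<inter> {x \<in> space M. ennreal (2 ^ k) < f x}"
      using sets.sets_into_space[OF E] by auto
    then show ?thesis by simp
  qed
  \<comment> \<open>Truncating at \<open>2 ^ N\<close> allows an induction on \<open>N\<close>, and covers the points where \<open>f\<close> is infinite.\<close>
  have step: "min (f x) (ennreal (2 ^ N))
      \<le> 1 + (\<Sum>k<N. ennreal (2 ^ k) * indicator (?L k) x)" if "x \<in> E" for x N
  proof (induction N)
    case 0
    then show ?case by simp
  next
    case (Suc N)
    have "min (f x) (ennreal (2 ^ Suc N))
        \<le> min (f x) (ennreal (2 ^ N)) + ennreal (2 ^ N) * indicator (?L N) x"
    proof (cases "ennreal (2 ^ N) < f x")
      case True
      have "ennreal (2 ^ Suc N) = ennreal (2 ^ N) + ennreal (2 ^ N)"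
        by (simp flip: ennreal_plus)
      moreover have "min (f x) (ennreal (2 ^ N)) = ennreal (2 ^ N)"
        using True by (intro min_absorb2 less_imp_le)
      ultimately show ?thesis using True that by simp
    next
      case False
      then have "min (f x) (ennreal (2 ^ N)) = f x" by (simp add: min_def not_less)
      then show ?thesis by (simp add: add_increasing2)
    qed
    also have "\<dots> \<le> (1 + (\<Sum>k<N. ennreal (2 ^ k) * indicator (?L k) x))
        + ennreal (2 ^ N) * indicator (?L N) x"
      by (intro add_right_mono Suc)
    finally show ?case by (simp add: add.assoc)
  qed
  have pointwise: "f x * indicator E x \<le> indicator E x + (\<Sum>k. ennreal (2 ^ k) * indicator (?L k) x)" for x
  proof (cases "x \<in> E")
    case True
    let ?S = "1 + (\<Sum>k. ennreal (2 ^ k) * indicator (?L k) x)"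
    have le: "min (f x) (ennreal (2 ^ N)) \<le> ?S" for N
      by (rule order_trans[OF step[OF True]]) (intro add_left_mono sum_le_suminf; simp)
    have "f x \<le> ?S"
    proof (cases "?S = \<infinity>")
      case False
      then obtain s where s: "?S = ennreal s" "s \<ge> 0"
        by (cases ?S) auto
      obtain N where N: "s < 2 ^ N" using real_arch_pow[of 2 s] by auto
      have "\<not> ennreal (2 ^ N) \<le> ?S" using N s by (simp add: ennreal_le_iff)
      then show ?thesis using le[of N] by (auto simp: min_def split: if_splits)
    qed (simp add: infinity_ennreal_def)
    then show ?thesis using True by simp
  qed simp
  have r: "2 powr (1 - q) < (1::real)" using q by (simp add: powr_less_one)
  have "(\<integral>\<^sup>+x\<in>E. f x \<partial>M)
      \<le> (\<integral>\<^sup>+x. indicator E x + (\<Sum>k. ennreal (2 ^ k) * indicator (?L k) x) \<partial>M)"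
    by (intro nn_integral_mono pointwise)
  also have "\<dots> = emeasure M E + (\<Sum>k. ennreal (2 ^ k) * emeasure M (?L k))"
    by (simp add: nn_integral_add nn_integral_suminf nn_integral_cmult_indicator)
  also have "\<dots> \<le> emeasure M E + (\<Sum>k. ennreal (B * (2 powr (1 - q)) ^ k))"
  proof (intro add_left_mono suminf_le)
    fix k :: nat
    have "ennreal (2 ^ k) * emeasure M (?L k) \<le> ennreal (2 ^ k) * ennreal (B * (2 ^ k) powr (- q))"
      by (intro mult_left_mono weak) simp
    also have "\<dots> = ennreal (B * (2 powr (1 - q)) ^ k)"
      using B by (simp flip: ennreal_mult add: powr_realpow[symmetric] powr_powr powr_add[symmetric] algebra_simps)
    finally show "ennreal (2 ^ k) * emeasure M (?L k) \<le> ennreal (B * (2 powr (1 - q)) ^ k)" .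
  qed auto
  also have "(\<Sum>k. ennreal (B * (2 powr (1 - q)) ^ k)) = ennreal (B / (1 - 2 powr (1 - q)))"
    using r B geometric_sums[of "2 powr (1 - q)"]
    by (intro suminf_ennreal_eq) (auto intro: sums_mult simp: divide_inverse)
  finally show ?thesis .
qed

lemma nn_integral_lborel_translate:
  fixes f :: "'a::euclidean_space \<Rightarrow> ennreal"
  assumes [measurable]: "f \<in> borel_measurable borel"
  shows "(\<integral>\<^sup>+x. f (c + x) \<partial>lborel) = (\<integral>\<^sup>+x. f x \<partial>lborel)"
  by (subst (2) lborel_distr_plus[of c, symmetric]) (simp add: nn_integral_distr)

text \<open>
  The measure \<open>F \<mapsto> \<integral> F (g x) dx\<close> is invariant under translations, hence a multiple of the
  Lebesgue measure, and the factor can be read off from the unit ball \<open>B\<close>: the preimage of \<open>B\<close>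
  under \<open>g\<close> contains \<open>B\<close>, so the factor is at least one. The proof is the uniqueness argument
  for Haar measure, applied to the double integral of \<open>f (g x)\<close> against the indicator of \<open>B\<close>. It
  is used for multiplication by a complex scalar, for which it replaces a Jacobian determinant.
\<close>
lemma nn_integral_le_linear_contraction:
  fixes g :: "'a::euclidean_space \<Rightarrow> 'a" and f :: "'a \<Rightarrow> ennreal"
  assumes g: "linear g" and norm_g: "\<And>x. norm (g x) = k * norm x"
    and k: "0 < k" "k \<le> 1" and f [measurable]: "f \<in> borel_measurable borel"
  shows "(\<integral>\<^sup>+x. f x \<partial>lborel) \<le> (\<integral>\<^sup>+x. f (g x) \<partial>lborel)"
proof -
  interpret linear g by fact
  have "continuous_on UNIV g" using g by (simp add: linear_continuous_on linear_conv_bounded_linear)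
  then have g_meas [measurable]: "g \<in> borel_measurable borel" by (rule borel_measurable_continuous_onI)
  have "inj g"
    using norm_g k by (intro injI) (metis diff eq_iff_diff_eq_0 norm_eq_zero mult_eq_0_iff less_numeral_extra(3))
  then have "surj g" using g linear_inj_imp_surj by blast
  note shift = nn_integral_lborel_translate
  have g_shift: "(\<integral>\<^sup>+x. F (g x + y) \<partial>lborel) = (\<integral>\<^sup>+x. F (g x) \<partial>lborel)"
    if [measurable]: "F \<in> borel_measurable borel" for F :: "'a \<Rightarrow> ennreal" and y
  proof -
    obtain c where "y = g c" using \<open>surj g\<close> by auto
    then show ?thesis using shift[of "\<lambda>x. F (g x)" c] by (simp add: add add.commute)
  qed
  let ?h = "indicator (ball 0 1) :: 'a \<Rightarrow> ennreal"
  have [measurable]: "(\<lambda>x. ?h (F x)) \<in> borel_measurable M"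
    if "F \<in> borel_measurable M" for F and M :: "'b measure"
    using that by (rule measurable_compose) (intro borel_measurable_indicator, simp)
  let ?B = "emeasure lborel (ball (0::'a) 1)"
  have vol: "?B \<noteq> 0" "?B \<noteq> \<infinity>"
    using content_ball_pos[of 1 "0::'a"] emeasure_lborel_ball_finite[of "0::'a" 1]
    by (auto simp: measure_def)
  have inner: "?B \<le> (\<integral>\<^sup>+x. ?h (y - g x) \<partial>lborel)" for y
  proof -
    have "?B = (\<integral>\<^sup>+x. ?h x \<partial>lborel)" by simp
    also have "\<dots> \<le> (\<integral>\<^sup>+x. ?h (- g x) \<partial>lborel)"
    proof (rule nn_integral_mono)
      fix x :: 'a
      have "norm (g x) \<le> norm x" using k by (simp add: norm_g mult_left_le_one_le)
      then show "?h x \<le> ?h (- g x)" by (auto simp: indicator_def)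
    qed
    also have "\<dots> = (\<integral>\<^sup>+x. ?h (y - g x) \<partial>lborel)"
      using g_shift[of "\<lambda>x. ?h (- x)" "- y"] by simp
    finally show ?thesis .
  qed
  have "?B * (\<integral>\<^sup>+y. f y \<partial>lborel) = (\<integral>\<^sup>+y. f y * ?B \<partial>lborel)"
    by (simp add: nn_integral_multc mult.commute)
  also have "\<dots> \<le> (\<integral>\<^sup>+y. f y * (\<integral>\<^sup>+x. ?h (y - g x) \<partial>lborel) \<partial>lborel)"
    by (intro nn_integral_mono mult_left_mono inner) simp
  also have "\<dots> = (\<integral>\<^sup>+y. (\<integral>\<^sup>+x. f y * ?h (y - g x) \<partial>lborel) \<partial>lborel)"
    by (simp add: nn_integral_cmult)
  also have "\<dots> = (\<integral>\<^sup>+x. (\<integral>\<^sup>+y. f y * ?h (y - g x) \<partial>lborel) \<partial>lborel)"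
    by (rule lborel_pair.Fubini') measurable
  also have "\<dots> = (\<integral>\<^sup>+x. (\<integral>\<^sup>+y. f (g x + y) * ?h y \<partial>lborel) \<partial>lborel)"
  proof (rule nn_integral_cong)
    fix x
    show "(\<integral>\<^sup>+y. f y * ?h (y - g x) \<partial>lborel) = (\<integral>\<^sup>+y. f (g x + y) * ?h y \<partial>lborel)"
      using shift[of "\<lambda>y. f y * ?h (y - g x)" "g x"] by simp
  qed
  also have "\<dots> = (\<integral>\<^sup>+y. (\<integral>\<^sup>+x. f (g x + y) * ?h y \<partial>lborel) \<partial>lborel)"
    by (rule lborel_pair.Fubini') measurable
  also have "\<dots> = (\<integral>\<^sup>+y. (\<integral>\<^sup>+x. f (g x) \<partial>lborel) * ?h y \<partial>lborel)"
    by (simp add: nn_integral_multc g_shift)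
  also have "\<dots> = ?B * (\<integral>\<^sup>+x. f (g x) \<partial>lborel)"
    by (subst nn_integral_cmult_indicator) (simp_all add: mult.commute)
  finally show ?thesis using vol by (simp add: ennreal_mult_le_mult_iff top.not_eq_extremum)
qed

lemma norm_vector_scalar_mult: "norm (\<zeta> *s w) = norm \<zeta> * norm (w :: complex^'n)"
  unfolding norm_vec_def L2_set_def vector_scalar_mult_def
  by (simp add: norm_mult power_mult_distrib real_sqrt_mult flip: sum_distrib_left)

lemma linear_vector_scalar_mult: "linear (\<lambda>w :: complex^'n. \<zeta> *s w)"
  by (intro linearI) (auto simp: vec_eq_iff algebra_simps)

lemma continuous_on_vector_scalar_mult [continuous_intros]:
  fixes f :: "'a::topological_space \<Rightarrow> complex" and g :: "'a \<Rightarrow> complex^'n"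
  assumes "continuous_on S f" "continuous_on S g"
  shows "continuous_on S (\<lambda>x. f x *s g x)"
  unfolding vector_scalar_mult_def
  by (intro continuous_intros continuous_on_vec_lambda assms)

text \<open>
  Integration in polar coordinates with complex radii. Integrating \<open>f (\<zeta> w)\<close> over \<open>w\<close> in a ball
  gives, for every fixed \<open>\<zeta>\<close> with \<open>1/2 \<le> \<bar>\<zeta>\<bar> < 1\<close>, at least the integral of \<open>f\<close> over the ball of
  half the radius. Integrating this over the annulus and exchanging the integrals leaves the
  integrals of \<open>f\<close> over complex lines. Since \<open>\<zeta>\<close> is kept away from \<open>0\<close>, no weight \<open>\<bar>\<zeta>\<bar> ^ (2n -
  2)\<close> appears and no parametrisation of the set of lines is needed.
\<close>
lemma nn_integral_ball_le_complex_slices: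
  fixes f :: "complex^'n \<Rightarrow> ennreal"
  assumes f [measurable]: "f \<in> borel_measurable borel"
    and slices: "\<And>w. norm w < \<rho> \<Longrightarrow> (\<integral>\<^sup>+\<zeta>\<in>ball 0 1. f (\<zeta> *s w) \<partial>lborel) \<le> C"
    and C: "C < \<infinity>"
  shows "(\<integral>\<^sup>+v\<in>ball 0 (\<rho> / 2). f v \<partial>lborel) < \<infinity>"
proof -
  let ?A = "ball 0 1 - ball 0 (1/2) :: complex set"
  have scal: "(\<lambda>(\<zeta>, w :: complex^'n). \<zeta> *s w) \<in> borel_measurable borel"
    unfolding split_beta by (intro borel_measurable_continuous_onI continuous_intros)
  have [measurable]: "(\<lambda>x. F x *s G x) \<in> borel_measurable M"
    if [measurable]: "F \<in> borel_measurable M" "G \<in> borel_measurable M"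
    for F :: "complex \<times> (complex^'n) \<Rightarrow> complex" and G :: "complex \<times> (complex^'n) \<Rightarrow> complex^'n" and M
  proof -
    have "(\<lambda>x. (F x, G x)) \<in> borel_measurable M" by measurable
    from measurable_compose[OF this scal] show ?thesis by simp
  qed
  let ?F = "\<lambda>\<zeta> w. f (\<zeta> *s w) * indicator (ball 0 \<rho>) w * indicator ?A \<zeta>"
  have [measurable]: "(\<lambda>x. indicator (ball 0 \<rho>) (snd x)) \<in> borel_measurable (lborel \<Otimes>\<^sub>M lborel)"
    "(\<lambda>x. indicator ?A (fst x)) \<in> borel_measurable (lborel \<Otimes>\<^sub>M lborel)"
    by (rule measurable_compose[OF measurable_snd], intro borel_measurable_indicator, simp)
       (rule measurable_compose[OF measurable_fst], intro borel_measurable_indicator, simp)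
  have meas: "case_prod ?F \<in> borel_measurable (lborel \<Otimes>\<^sub>M lborel)"
    by measurable
  let ?I = "\<integral>\<^sup>+v\<in>ball 0 (\<rho> / 2). f v \<partial>lborel"
  \<comment> \<open>The annulus has positive area because it contains this disc.\<close>
  have annulus: "emeasure lborel ?A \<noteq> 0"
  proof -
    have "ball (3/4) (1/4) \<subseteq> ?A"
    proof
      fix x :: complex assume "x \<in> ball (3/4) (1/4)"
      then have x: "norm (3/4 - x) < 1/4" by (simp add: dist_norm)
      have "norm (3/4 :: complex) = 3/4" by simp
      then have "norm x < 1" "1/2 \<le> norm x"
        using x norm_triangle_ineq2[of x "3/4"] norm_triangle_ineq2[of "3/4" x]
        by (simp_all add: norm_minus_commute)
      then show "x \<in> ?A" by simp
    qed
    then have "emeasure lborel (ball (3/4) (1/4) :: complex set) \<le> emeasure lborel ?A"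
      by (intro emeasure_mono) auto
    moreover have "emeasure lborel (ball (3/4) (1/4) :: complex set) \<noteq> 0"
      using content_ball_pos[of "1/4" "3/4::complex"] by (auto simp: measure_def)
    ultimately show ?thesis by auto
  qed
  have slice_avg: "?I \<le> (\<integral>\<^sup>+w. f (\<zeta> *s w) * indicator (ball 0 \<rho>) w \<partial>lborel)" if "\<zeta> \<in> ?A" for \<zeta>
  proof -
    have "?I \<le> (\<integral>\<^sup>+w. f (\<zeta> *s w) * indicator (ball 0 (\<rho> / 2)) (\<zeta> *s w) \<partial>lborel)"
      by (rule nn_integral_le_linear_contraction[OF linear_vector_scalar_mult, of _ "norm \<zeta>"])
         (use that in \<open>auto simp: norm_vector_scalar_mult intro!: borel_measurable_times_ennreal borel_measurable_indicator f\<close>)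
    also have "\<dots> \<le> (\<integral>\<^sup>+w. f (\<zeta> *s w) * indicator (ball 0 \<rho>) w \<partial>lborel)"
    proof (intro nn_integral_mono mult_left_mono)
      fix w :: "complex^'n"
      have "norm w \<le> 2 * norm (\<zeta> *s w)"
        using that mult_right_mono[of "1/2" "norm \<zeta>" "norm w"] by (simp add: norm_vector_scalar_mult)
      then show "(indicator (ball 0 (\<rho> / 2)) (\<zeta> *s w) :: ennreal) \<le> indicator (ball 0 \<rho>) w"
        by (auto simp: indicator_def)
    qed simp
    finally show ?thesis .
  qed
  have "?I * emeasure lborel ?A = (\<integral>\<^sup>+\<zeta>. ?I * indicator ?A \<zeta> \<partial>lborel)"
    by (subst nn_integral_cmult_indicator) auto
  also have "\<dots> \<le> (\<integral>\<^sup>+\<zeta>. (\<integral>\<^sup>+w. ?F \<zeta> w \<partial>lborel) \<partial>lborel)"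
  proof (rule nn_integral_mono)
    fix \<zeta> :: complex
    show "?I * indicator ?A \<zeta> \<le> (\<integral>\<^sup>+w. ?F \<zeta> w \<partial>lborel)"
      using slice_avg[of \<zeta>] by (cases "\<zeta> \<in> ?A") auto
  qed
  also have "\<dots> = (\<integral>\<^sup>+w. (\<integral>\<^sup>+\<zeta>. ?F \<zeta> w \<partial>lborel) \<partial>lborel)"
    by (rule lborel_pair.Fubini'[OF meas, symmetric])
  also have "\<dots> \<le> (\<integral>\<^sup>+w\<in>ball (0 :: complex^'n) \<rho>. C \<partial>lborel)"
  proof (rule nn_integral_mono)
    fix w :: "complex^'n"
    show "(\<integral>\<^sup>+\<zeta>. ?F \<zeta> w \<partial>lborel) \<le> C * indicator (ball 0 \<rho>) w"
    proof (cases "norm w < \<rho>")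
      case True
      have "(\<integral>\<^sup>+\<zeta>. ?F \<zeta> w \<partial>lborel) \<le> (\<integral>\<^sup>+\<zeta>\<in>ball 0 1. f (\<zeta> *s w) \<partial>lborel)"
        by (intro nn_integral_mono) (auto simp: indicator_def)
      then show ?thesis using slices[OF True] True by simp
    qed simp
  qed
  also have "\<dots> = C * emeasure lborel (ball (0 :: complex^'n) \<rho>)"
    by (subst nn_integral_cmult_indicator) auto
  also have "\<dots> < \<infinity>"
    using C emeasure_lborel_ball_finite[of "0 :: complex^'n" \<rho>] by (simp add: ennreal_mult_less_top)
  finally show ?thesis using annulus by (auto simp: ennreal_mult_less_top)
qed

section \<open>Means over circles\<close>

lemma holomorphic_circle_mean:
  assumes f: "continuous_on (cball a r) f" "f holomorphic_on ball a r" and r: "r > 0"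
  shows "((\<lambda>\<theta>. f (a + of_real r * cis \<theta>)) has_integral (of_real (2 * pi) * f a)) {0..2*pi}"
proof -
  have "((\<lambda>u. f u / (u - a)) has_contour_integral (2 * of_real pi * \<i> * f a)) (circlepath a r)"
    using r by (intro Cauchy_integral_circlepath[OF f]) simp
  then have "((\<lambda>t. f (a + of_real r * cis t) / (a + of_real r * cis t - a) * of_real r * \<i> * cis t)
      has_integral (2 * of_real pi * \<i> * f a)) {0..2*pi}"
    unfolding circlepath_def by (subst (asm) has_contour_integral_part_circlepath_iff) auto
  then have "((\<lambda>t. f (a + of_real r * cis t) * \<i>) has_integral (2 * of_real pi * \<i> * f a)) {0..2*pi}"
    by (rule has_integral_eq[rotated]) (use r in auto)
  then have "((\<lambda>t. f (a + of_real r * cis t) * \<i> * (- \<i>)) has_integral (2 * of_real pi * \<i> * f a * (- \<i>))) {0..2*pi}"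
    by (rule has_integral_mult_left)
  then show ?thesis
    by (rule has_integral_eq_rhs[OF has_integral_eq[rotated]]) (auto simp: algebra_simps)
qed

text \<open>
  The logarithm of the distance to \<open>w\<close> is harmonic away from \<open>w\<close>. The quotient \<open>(z - w) / (a -
  w)\<close> stays in the disc of radius one around \<open>1\<close>, where the principal branch of the logarithm is
  holomorphic, so that the mean value property of holomorphic functions applies.
\<close>
lemma ln_norm_circle_mean:
  assumes "r > 0" and w: "w \<notin> cball a r"
  shows "((\<lambda>\<theta>. ln (norm (a + of_real r * cis \<theta> - w))) has_integral (2 * pi * ln (norm (a - w)))) {0..2*pi}"
proof -
  let ?q = "\<lambda>z. (z - w) / (a - w)"
  have aw: "r < norm (a - w)" using w by (simp add: dist_norm)
  then have [simp]: "a \<noteq> w" using \<open>r > 0\<close> by auto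
  have nonpos: "?q z \<notin> \<real>\<^sub>\<le>\<^sub>0" if "z \<in> cball a r" for z
  proof
    assume "?q z \<in> \<real>\<^sub>\<le>\<^sub>0"
    then have "Re (?q z) \<le> 0" by (simp add: complex_nonpos_Reals_iff)
    moreover have "?q z - 1 = (z - a) / (a - w)" by (simp add: field_simps)
    then have "norm (?q z - 1) < 1"
      using that aw \<open>r > 0\<close> by (simp add: norm_divide dist_norm norm_minus_commute divide_less_eq)
    moreover have "1 - Re (?q z) \<le> norm (?q z - 1)"
      using abs_Re_le_cmod[of "?q z - 1"] by simp
    ultimately show False by simp
  qed
  have cont: "continuous_on (cball a r) (\<lambda>z. Ln (?q z))"
    by (intro continuous_intros) (use nonpos in auto)
  have hol: "(\<lambda>z. Ln (?q z)) holomorphic_on ball a r"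
    by (intro holomorphic_intros) (use nonpos in auto)
  have "((\<lambda>\<theta>. Re (Ln (?q (a + of_real r * cis \<theta>)))) has_integral 0) {0..2*pi}"
    using has_integral_Re[OF holomorphic_circle_mean[OF cont hol \<open>r > 0\<close>]] by simp
  then have "((\<lambda>\<theta>. Re (Ln (?q (a + of_real r * cis \<theta>))) + ln (norm (a - w)))
      has_integral (0 + 2 * pi * ln (norm (a - w)))) {0..2*pi}"
    using has_integral_const_real[of "ln (norm (a - w))" 0 "2*pi"]
    by (intro has_integral_add) (auto simp: mult.commute)
  then show ?thesis
  proof (rule has_integral_eq[rotated, THEN has_integral_eq_rhs])
    fix \<theta> :: real
    have "a + of_real r * cis \<theta> \<in> cball a r" using \<open>r > 0\<close> by (simp add: dist_norm norm_mult)
    then have "a + of_real r * cis \<theta> \<noteq> w" using w by auto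
    then show "Re (Ln (?q (a + of_real r * cis \<theta>))) + ln (norm (a - w)) = ln (norm (a + of_real r * cis \<theta> - w))"
      by (simp add: norm_divide ln_div)
  qed simp
qed

text \<open>
  The excess \<open>r\<^sup>2\<close> of the mean over the central value is what makes a small multiple of \<open>\<bar>z\<bar>\<^sup>2\<close>
  a strictly subharmonic perturbation in the maximum principle below.
\<close>
lemma norm_square_circle_mean:
  assumes "r > 0"
  shows "((\<lambda>\<theta>. (norm (a + of_real r * cis \<theta>))\<^sup>2) has_integral (2 * pi * ((norm a)\<^sup>2 + r\<^sup>2))) {0..2*pi}"
proof -
  have "((\<lambda>\<theta>. Re (2 * cnj a * (a + of_real r * cis \<theta>))) has_integral Re (of_real (2 * pi) * (2 * cnj a * a))) {0..2*pi}"
    by (rule has_integral_Re[OF holomorphic_circle_mean[of a r "\<lambda>z. 2 * cnj a * z"]])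
       (intro continuous_intros holomorphic_intros assms)+
  from has_integral_add[OF this has_integral_const_real[of "r\<^sup>2 - (norm a)\<^sup>2" 0 "2*pi"]]
  have "((\<lambda>\<theta>. Re (2 * cnj a * (a + of_real r * cis \<theta>)) + (r\<^sup>2 - (norm a)\<^sup>2)) has_integral
      (2 * pi * ((norm a)\<^sup>2 + r\<^sup>2))) {0..2*pi}"
      by (rule has_integral_eq_rhs)
       (simp add: algebra_simps power2_eq_square cmod_power2[of a, unfolded power2_eq_square])
  then show ?thesis
  proof (rule has_integral_eq[rotated])
    fix \<theta> :: real
    let ?z = "of_real r * cis \<theta>"
    have "(norm ?z)\<^sup>2 = r\<^sup>2" by (simp add: norm_mult power_mult_distrib)
    moreover have "(norm (a + ?z))\<^sup>2 = 2 * Re (cnj a * (a + ?z)) + (norm ?z)\<^sup>2 - (norm a)\<^sup>2"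
      by (simp only: cmod_power2) (simp add: power2_eq_square algebra_simps)
    ultimately show "Re (2 * cnj a * (a + ?z)) + (r\<^sup>2 - (norm a)\<^sup>2) = (norm (a + ?z))\<^sup>2"
      by (simp add: algebra_simps)
  qed
qed

text \<open>
  A continuous real majorant on the circle bounds the extended-valued mean, whether or not \<open>u\<close>
  takes the value \<open>-\<infinity>\<close> there. This is how the mean of a subharmonic function is estimated from
  now on.
\<close>
lemma circle_mean_le_integral:
  assumes h: "continuous_on {0..2*pi} h" and I: "(h has_integral 2 * pi * m) {0..2*pi}"
    and le: "\<And>\<theta>. \<theta> \<in> {0..2*pi} \<Longrightarrow> u (a + of_real r * cis \<theta>) \<le> ereal (h \<theta>)"
  shows "circle_mean u a r \<le> ereal m"
proof -
  let ?S = "{0..2*pi}"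
  let ?P = "\<integral>\<^sup>+\<theta>\<in>?S. e2ennreal (u (a + of_real r * cis \<theta>)) \<partial>lborel"
  let ?N = "\<integral>\<^sup>+\<theta>\<in>?S. e2ennreal (- u (a + of_real r * cis \<theta>)) \<partial>lborel"
  define p where "p = (LINT \<theta>:?S|lborel. max 0 (h \<theta>))"
  define n where "n = (LINT \<theta>:?S|lborel. max 0 (- h \<theta>))"
  have int: "set_integrable lborel ?S (\<lambda>\<theta>. max 0 (h \<theta>))" "set_integrable lborel ?S (\<lambda>\<theta>. max 0 (- h \<theta>))"
    unfolding set_integrable_def by (intro borel_integrable_compact continuous_intros h compact_Icc)+
  have "?P \<le> (\<integral>\<^sup>+\<theta>. ennreal (indicator ?S \<theta> *\<^sub>R max 0 (h \<theta>)) \<partial>lborel)"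
  proof (rule nn_integral_mono)
    fix \<theta>
    show "e2ennreal (u (a + of_real r * cis \<theta>)) * indicator ?S \<theta> \<le> ennreal (indicator ?S \<theta> *\<^sub>R max 0 (h \<theta>))"
    proof (cases "\<theta> \<in> ?S")
      case True
      have "e2ennreal (u (a + of_real r * cis \<theta>)) \<le> e2ennreal (ereal (h \<theta>))"
        by (intro e2ennreal_mono le True)
      also have "\<dots> = ennreal (max 0 (h \<theta>))" by (simp add: e2ennreal_ereal max_def ennreal_neg)
      finally show ?thesis using True by simp
    qed simp
  qed
  also have "\<dots> = ennreal p"
    unfolding p_def set_lebesgue_integral_def
    by (intro nn_integral_eq_integral int[unfolded set_integrable_def]) (auto simp: indicator_def)
  finally have P: "?P \<le> ennreal p" .
  have "ennreal n = (\<integral>\<^sup>+\<theta>. ennreal (indicator ?S \<theta> *\<^sub>R max 0 (- h \<theta>)) \<partial>lborel)"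
    unfolding n_def set_lebesgue_integral_def
    by (intro nn_integral_eq_integral[symmetric] int[unfolded set_integrable_def]) (auto simp: indicator_def)
  also have "\<dots> \<le> ?N"
  proof (rule nn_integral_mono)
    fix \<theta>
    show "ennreal (indicator ?S \<theta> *\<^sub>R max 0 (- h \<theta>)) \<le> e2ennreal (- u (a + of_real r * cis \<theta>)) * indicator ?S \<theta>"
    proof (cases "\<theta> \<in> ?S")
      case True
      have "ennreal (max 0 (- h \<theta>)) = e2ennreal (- ereal (h \<theta>))" by (simp add: e2ennreal_ereal max_def ennreal_neg)
      also have "\<dots> \<le> e2ennreal (- u (a + of_real r * cis \<theta>))"
        using le[OF True] by (intro e2ennreal_mono) (simp only: ereal_minus_le_minus)
      finally show ?thesis using True by simp
    qed simp
  qed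
  finally have N: "ennreal n \<le> ?N" .
  have "p \<ge> 0" "n \<ge> 0"
    unfolding p_def n_def set_lebesgue_integral_def by (auto intro!: integral_nonneg_AE simp: indicator_def)
  have "p - n = (LINT \<theta>:?S|lborel. max 0 (h \<theta>) - max 0 (- h \<theta>))"
    unfolding p_def n_def using int by simp
  also have "\<dots> = (LINT \<theta>:?S|lborel. h \<theta>)"
    by (intro arg_cong[of _ _ "set_lebesgue_integral lborel ?S"]) auto
  also have "\<dots> = integral ?S h"
    using borel_integrable_compact[OF compact_Icc h]
    by (intro set_borel_integral_eq_integral) (simp add: set_integrable_def)
  also have "\<dots> = 2 * pi * m" using I by (rule integral_unique)
  finally have pn: "p - n = 2 * pi * m" .
  have "enn2ereal ?P - enn2ereal ?N \<le> ereal p - ereal n"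
    using P N \<open>p \<ge> 0\<close> \<open>n \<ge> 0\<close>
    by (intro ereal_minus_mono) (simp_all add: less_eq_ennreal.rep_eq enn2ereal_ennreal)
  then have "circle_mean u a r \<le> ereal (2 * pi * m) / ereal (2 * pi)"
    unfolding circle_mean_def pn[symmetric] by (intro ereal_divide_right_mono) auto
  then show ?thesis by simp
qed

lemma open_sublevel_if_upper_semicontinuous:
  assumes "upper_semicontinuous_on \<Omega> \<phi>" "open B" "B \<subseteq> \<Omega>"
  shows "open {z\<in>B. \<phi> z < c}"
proof (subst open_subopen, clarify)
  fix x assume x: "x \<in> B" "\<phi> x < c"
  then have "\<forall>\<^sub>F y in at x within \<Omega>. \<phi> y < c"
    using assms unfolding upper_semicontinuous_on_def by blast
  moreover have "x \<in> interior \<Omega>" using interior_maximal[OF assms(3,2)] x by blast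
  ultimately have "\<forall>\<^sub>F y in at x. \<phi> y < c" by (simp only: at_within_interior)
  then obtain S where S: "open S" "x \<in> S" "\<And>y. y \<in> S \<Longrightarrow> y \<noteq> x \<Longrightarrow> \<phi> y < c"
    unfolding eventually_at_topological by blast
  show "\<exists>S. open S \<and> x \<in> S \<and> S \<subseteq> {z\<in>B. \<phi> z < c}"
    using S x assms(2) by (intro exI[of _ "S \<inter> B"]) auto
qed

lemma usc_compact_attains_sup:
  fixes f :: "'a::topological_space \<Rightarrow> ereal"
  assumes X: "compact X" "X \<noteq> {}"
    and usc: "\<And>x c. x \<in> X \<Longrightarrow> f x < c \<Longrightarrow> \<forall>\<^sub>F y in at x within X. f y < c"
  obtains x where "x \<in> X" "\<And>y. y \<in> X \<Longrightarrow> f y \<le> f x"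
proof -
  have "\<exists>x\<in>X. \<forall>y\<in>X. f y \<le> f x"
  proof (rule ccontr)
    assume "\<not> ?thesis"
    then have "\<forall>x\<in>X. \<exists>y\<in>X. f x < f y" by (simp add: not_le)
    then obtain b where b: "\<And>x. x \<in> X \<Longrightarrow> b x \<in> X \<and> f x < f (b x)" by metis
    have "\<exists>U. open U \<and> x \<in> U \<and> (\<forall>y\<in>U \<inter> X. f y < f (b x))" if "x \<in> X" for x
      using usc[OF that, of "f (b x)"] b[OF that] unfolding eventually_at_topological by (metis IntE)
    then obtain U where U: "\<And>x. x \<in> X \<Longrightarrow> open (U x) \<and> x \<in> U x \<and> (\<forall>y\<in>U x \<inter> X. f y < f (b x))"
      by metis
    obtain F where F: "F \<subseteq> X" "finite F" "X \<subseteq> (\<Union>x\<in>F. U x)"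
      using compactE_image[OF X(1), of X U] U by blast
    have "F \<noteq> {}" using F X by auto
    then obtain x where x: "x \<in> F" "\<And>y. y \<in> F \<Longrightarrow> f (b y) \<le> f (b x)"
      using finite_imp_Sup_less Max_in[of "(\<lambda>y. f (b y)) ` F"] Max_ge[of "(\<lambda>y. f (b y)) ` F"] F(2)
      by (smt (verit, ccfv_SIG) finite_imageI imageE image_eqI image_is_empty)
    have "b x \<in> X" using x F b by auto
    then obtain y where "y \<in> F" "b x \<in> U y" using F by auto
    then have "f (b x) < f (b y)" using U[of y] F \<open>b x \<in> X\<close> by auto
    with x(2)[OF \<open>y \<in> F\<close>] show False by simp
  qed
  then show ?thesis using that by auto
qed

text \<open>
  The maximum principle for \<open>u + g\<close>, where \<open>g\<close> has the mean value property off a closed set \<open>K\<close>,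
  and where the sum is known to be nonpositive on an open neighbourhood \<open>W\<close> of \<open>K\<close> and on the
  boundary circle. After adding \<open>\<epsilon> \<bar>z\<bar>\<^sup>2\<close>, an interior maximum contradicts the submean
  inequality at once, because the mean over a small circle exceeds the value at the centre by at
  least \<open>\<epsilon> r\<^sup>2\<close>. Working with the neighbourhood \<open>W\<close> instead of \<open>K\<close> makes the remaining set
  compact and disjoint from \<open>K\<close>, so that \<open>g\<close> has to be continuous only off \<open>K\<close>.
\<close>
lemma subharmonic_maximum_principle:
  assumes u: "subharmonic_on V u" "cball 0 T \<subseteq> V" and T: "T > 0"
    and KW: "closed K" "open W" "K \<subseteq> W"
    and g: "continuous_on (- K) g"
    and g_mean: "\<And>a r. r > 0 \<Longrightarrow> cball a r \<inter> K = {} \<Longrightarrow>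
      ((\<lambda>\<theta>. g (a + of_real r * cis \<theta>)) has_integral 2 * pi * g a) {0..2*pi}"
    and bd: "\<And>z. z \<in> cball 0 T \<Longrightarrow> z \<in> W \<or> norm z = T \<Longrightarrow> u z + ereal (g z) \<le> 0"
    and z: "z \<in> cball 0 T"
  shows "u z + ereal (g z) \<le> 0"
proof -
  have fin: "u x < \<infinity>" if "x \<in> cball 0 T" for x
    using u that by (auto simp: subharmonic_on_def)
  have perturbed: "u z + ereal (g z + \<epsilon> * (norm z)\<^sup>2) \<le> ereal (\<epsilon> * T\<^sup>2)" if \<epsilon>: "\<epsilon> > 0" for \<epsilon>
  proof (rule ccontr)
    define f where "f = (\<lambda>x. u x + ereal (g x + \<epsilon> * (norm x)\<^sup>2))"
    assume "\<not> ?thesis"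
    then have fz: "f z > ereal (\<epsilon> * T\<^sup>2)" by (simp add: f_def)
    have f_small: "f x \<le> ereal (\<epsilon> * T\<^sup>2)" if x: "x \<in> cball 0 T" "x \<in> W \<or> norm x = T" for x
    proof -
      have "f x = (u x + ereal (g x)) + ereal (\<epsilon> * (norm x)\<^sup>2)"
        by (simp add: f_def add.assoc)
      also have "\<dots> \<le> 0 + ereal (\<epsilon> * T\<^sup>2)"
        using x \<epsilon> by (intro add_mono bd) (auto intro!: power_mono)
      finally show ?thesis by simp
    qed
    let ?X = "cball 0 T - W"
    have "z \<in> ?X" using f_small[of z] fz z by auto
    have "compact ?X" using KW(2) by (intro compact_diff) auto
    have usc: "\<forall>\<^sub>F y in at x within ?X. f y < c" if x: "x \<in> ?X" and less: "f x < c" for x c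
    proof -
      let ?h = "\<lambda>x. g x + \<epsilon> * (norm x)\<^sup>2"
      have "u x < c - ereal (?h x)"
        using less by (cases "u x"; cases c) (auto simp: f_def)
      then obtain d where d: "u x < ereal d" "ereal d < c - ereal (?h x)"
        using ereal_dense2 by blast
      have "continuous_on ?X ?h"
        by (intro continuous_intros continuous_on_subset[OF g]) (use KW in auto)
      then have lim: "(?h \<longlongrightarrow> ?h x) (at x within ?X)"
        using x by (auto simp: continuous_on_def)
      have "\<forall>\<^sub>F y in at x within V. u y < ereal d"
        using u x d(1) by (auto simp: subharmonic_on_def upper_semicontinuous_on_def)
      then have 1: "\<forall>\<^sub>F y in at x within ?X. u y < ereal d"
        by (rule filter_leD[rotated]) (use u in \<open>auto intro: at_le\<close>)
      show ?thesis
      proof (cases c)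
        case (real c')
        have "?h x < c' - d" using d(2) real by simp
        then have "\<forall>\<^sub>F y in at x within ?X. ?h y < c' - d"
          using lim by (rule order_tendstoD(2)[rotated])
        with 1 show ?thesis
        proof eventually_elim
          case (elim y)
          then show ?case using real by (cases "u y") (auto simp: f_def)
        qed
      next
        case PInf
        from 1 show ?thesis
        proof eventually_elim
          case (elim y)
          then show ?case using PInf by (cases "u y") (auto simp: f_def)
        qed
      qed (use less in auto)
    qed
    obtain a where a: "a \<in> ?X" "\<And>y. y \<in> ?X \<Longrightarrow> f y \<le> f a"
      using usc_compact_attains_sup[OF \<open>compact ?X\<close> _ usc] \<open>z \<in> ?X\<close> by blast
    have fa: "f a > ereal (\<epsilon> * T\<^sup>2)" using a(2)[OF \<open>z \<in> ?X\<close>] fz by simp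
    then obtain x where x: "u a = ereal x"
      using fin[of a] a(1) by (cases "u a") (auto simp: f_def)
    define m where "m = x + (g a + \<epsilon> * (norm a)\<^sup>2)"
    have f_le: "f y \<le> ereal m" if "y \<in> cball 0 T" for y
    proof -
      have "f a = ereal m" using x by (simp add: f_def m_def)
      then show ?thesis using f_small[of y] a(2)[of y] fa that by (cases "y \<in> W") (auto intro: order_trans)
    qed
    have "a \<in> ball 0 T - K"
      using a(1) f_small[of a] fa KW by fastforce
    moreover have "open (ball 0 T - K)" using KW by (intro open_Diff) auto
    ultimately obtain r where r: "r > 0" "cball a r \<subseteq> ball 0 T - K"
      using open_contains_cball by blast
    have circ: "a + of_real r * cis \<theta> \<in> ball 0 T - K" for \<theta>
      using r by (intro subsetD[OF r(2)]) (simp add: dist_norm norm_mult)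
    \<comment> \<open>On the circle, maximality of \<open>a\<close> bounds \<open>u\<close> by the continuous function \<open>h\<close>.\<close>
    define h where "h = (\<lambda>\<theta>. m - g (a + of_real r * cis \<theta>) - \<epsilon> * (norm (a + of_real r * cis \<theta>))\<^sup>2)"
    have "u a \<le> circle_mean u a r"
    proof -
      have "cball a r \<subseteq> V" using r(2) u(2) ball_subset_cball[of 0 T] by blast
      then show ?thesis using u(1) r(1) by (auto simp: subharmonic_on_def)
    qed
    also have "\<dots> \<le> ereal (m - g a - \<epsilon> * ((norm a)\<^sup>2 + r\<^sup>2))"
    proof (rule circle_mean_le_integral)
      show "continuous_on {0..2*pi} h" unfolding h_def
        by (intro continuous_intros continuous_on_compose2[OF g]) (use circ in auto)
      have "((\<lambda>\<theta>. m) has_integral 2 * pi * m) {0..2*pi}"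
        using has_integral_const_real[of m 0 "2*pi"] by simp
      moreover have "((\<lambda>\<theta>. g (a + of_real r * cis \<theta>)) has_integral 2 * pi * g a) {0..2*pi}"
        using r by (intro g_mean) auto
      moreover note has_integral_mult_right[OF norm_square_circle_mean[OF r(1)], of \<epsilon> a]
      ultimately have "(h has_integral (2 * pi * m - 2 * pi * g a - \<epsilon> * (2 * pi * ((norm a)\<^sup>2 + r\<^sup>2)))) {0..2*pi}"
        unfolding h_def by (intro has_integral_diff)
      then show "(h has_integral 2 * pi * (m - g a - \<epsilon> * ((norm a)\<^sup>2 + r\<^sup>2))) {0..2*pi}"
        by (rule has_integral_eq_rhs) (simp add: algebra_simps)
      show "u (a + of_real r * cis \<theta>) \<le> ereal (h \<theta>)" for \<theta>
        using f_le[of "a + of_real r * cis \<theta>"] circ[of \<theta>]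
        by (cases "u (a + of_real r * cis \<theta>)") (auto simp: f_def h_def)
    qed
    also have "\<dots> < ereal x" using r(1) \<epsilon> by (simp add: m_def algebra_simps)
    finally show False using x by simp
  qed
  show ?thesis
  proof (cases "u z")
    case (real x)
    show ?thesis
    proof (rule ccontr)
      assume "\<not> ?thesis"
      then have pos: "x + g z > 0" using real by simp
      define \<epsilon> where "\<epsilon> = (x + g z) / (2 * T\<^sup>2)"
      have \<epsilon>: "\<epsilon> > 0" using pos T by (simp add: \<epsilon>_def)
      from perturbed[OF this] have "x + g z + \<epsilon> * (norm z)\<^sup>2 \<le> \<epsilon> * T\<^sup>2"
        using real by (simp add: add.assoc)
      moreover have "\<epsilon> * T\<^sup>2 = (x + g z) / 2" using T by (simp add: \<epsilon>_def)
      moreover have "\<epsilon> * (norm z)\<^sup>2 \<ge> 0" using \<epsilon> by simp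
      ultimately show False using pos by simp
    qed
  qed (use fin[OF z] in auto)
qed

section \<open>Logarithmic potentials and the area of sublevel sets\<close>

text \<open>
  The set where the integrand exceeds \<open>2 ^ k\<close> lies in a disc of radius \<open>a / 2 ^ k\<close>, so this is a
  weak-type estimate with exponent two. The bound does not depend on the position of \<open>z\<close>
  relative to \<open>K\<close>.
\<close>
lemma nn_integral_inverse_norm_le:
  fixes z :: complex
  assumes [measurable]: "K \<in> sets borel" and a: "a \<ge> 0"
  shows "(\<integral>\<^sup>+w\<in>K. ennreal (a / norm (z - w)) \<partial>lborel) \<le> emeasure lborel K + ennreal (2 * pi * a\<^sup>2)"
proof -
  have "(\<integral>\<^sup>+w\<in>K. ennreal (a / norm (z - w)) \<partial>lborel)
      \<le> emeasure lborel K + ennreal (pi * a\<^sup>2 / (1 - 2 powr (1 - 2)))"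
  proof (rule nn_integral_weak_type_le)
    fix k :: nat
    have "{w\<in>K. ennreal (2 ^ k) < ennreal (a / norm (z - w))} \<subseteq> ball z (a / 2 ^ k)"
    proof clarify
      fix w assume "ennreal (2 ^ k) < ennreal (a / norm (z - w))"
      then have less: "2 ^ k < a / norm (z - w)" by (simp add: ennreal_less_iff)
      then have "z \<noteq> w" by auto
      then show "w \<in> ball z (a / 2 ^ k)" using less by (simp add: dist_norm field_simps)
    qed
    then have "emeasure lborel {w\<in>K. ennreal (2 ^ k) < ennreal (a / norm (z - w))} \<le> emeasure lborel (ball z (a / 2 ^ k))"
      by (intro emeasure_mono) auto
    also have "\<dots> = ennreal (pi * (a / 2 ^ k)\<^sup>2)"
      using a by (subst emeasure_ball) (auto simp: unit_ball_vol_2)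
    also have "pi * (a / 2 ^ k)\<^sup>2 = pi * a\<^sup>2 * (2 ^ k) powr (- 2)"
      by (simp add: powr_minus divide_inverse power_mult_distrib power_inverse)
    finally show "emeasure lborel {w\<in>K. ennreal (2 ^ k) < ennreal (a / norm (z - w))}
      \<le> ennreal (pi * a\<^sup>2 * (2 ^ k) powr (- 2))" .
  qed auto
  also have "pi * a\<^sup>2 / (1 - 2 powr (1 - 2)) = 2 * pi * a\<^sup>2"
    by (simp add: powr_minus)
  finally show ?thesis .
qed

definition log_potential :: "complex set \<Rightarrow> complex \<Rightarrow> real" where
  "log_potential K z = - (LINT w:K|lborel. ln (norm (z - w)))"

lemma ln_le_add_inverse:
  assumes "(x::real) \<ge> 0" shows "\<bar>ln x\<bar> \<le> x + 1 / x"
proof (cases "x = 0")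
  case False
  then have "x > 0" using assms by simp
  then have "ln x \<le> x - 1" "ln (1 / x) \<le> 1 / x - 1" by (intro ln_le_minus_one; simp)+
  moreover have "ln (1 / x) = - ln x" using \<open>x > 0\<close> by (simp add: ln_div)
  moreover have "1 / x > 0" using \<open>x > 0\<close> by simp
  ultimately show ?thesis using \<open>x > 0\<close> by linarith
qed simp

context
  fixes K :: "complex set"
  assumes K: "compact K"
begin

private lemma K_sets [measurable]: "K \<in> sets borel"
  using K by (simp add: borel_compact)

private lemma K_finite: "emeasure lborel K < \<infinity>"
  using K by (rule emeasure_compact_finite)

private lemma inverse_norm_integrable:
  "set_integrable lborel K (\<lambda>w. a / norm (z - w))" if "a \<ge> 0"
  unfolding set_integrable_def
proof (rule integrableI_nonneg)
  have "(\<integral>\<^sup>+w. ennreal (indicator K w *\<^sub>R (a / norm (z - w))) \<partial>lborel)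
      = (\<integral>\<^sup>+w\<in>K. ennreal (a / norm (z - w)) \<partial>lborel)"
    by (intro nn_integral_cong) (auto simp: indicator_def)
  also have "\<dots> \<le> emeasure lborel K + ennreal (2 * pi * a\<^sup>2)"
    by (rule nn_integral_inverse_norm_le[OF K_sets that])
  also have "\<dots> < \<infinity>" using K_finite by simp
  finally show "(\<integral>\<^sup>+w. ennreal (indicator K w *\<^sub>R (a / norm (z - w))) \<partial>lborel) < \<infinity>" .
qed (use that in \<open>auto simp: indicator_def\<close>)

private lemma ln_norm_integrable: "set_integrable lborel K (\<lambda>w. ln (norm (z - w)))"
proof -
  have "set_integrable lborel K (\<lambda>w. norm (z - w))"
    unfolding set_integrable_def by (intro borel_integrable_compact K continuous_intros)
  then have "set_integrable lborel K (\<lambda>w. norm (z - w) + 1 / norm (z - w))"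
    using inverse_norm_integrable[of 1 z] by (intro set_integral_add) auto
  then show ?thesis
  proof (rule set_integrable_bound)
    show "AE w in lborel. w \<in> K \<longrightarrow> norm (ln (norm (z - w))) \<le> norm (norm (z - w) + 1 / norm (z - w))"
      using ln_le_add_inverse[of "norm (z - _)"] by (intro AE_I2) (auto simp: abs_of_nonneg)
  qed (simp add: set_borel_measurable_def)
qed

text \<open>
  Among sets of given area the potential at \<open>z\<close> is largest for a disc around \<open>z\<close>. The bound with
  a non-optimal constant follows from \<open>- ln x \<le> - ln a + a/x - 1\<close>, with the radius \<open>a = sqrt
  (area K)\<close> of a disc of comparable area. The factor \<open>1/2\<close> in front of the logarithm is sharp,
  and it decides the exponent in the area estimate below.
\<close>
lemma log_potential_le:
  assumes pos: "measure lborel K > 0"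
  shows "log_potential K z \<le> measure lborel K * (2 * pi - ln (measure lborel K) / 2)"
proof -
  let ?\<mu> = "measure lborel K"
  define a where "a = sqrt ?\<mu>"
  have a: "a > 0" "a\<^sup>2 = ?\<mu>" using pos by (auto simp: a_def)
  have emeasure_K: "emeasure lborel K = ennreal ?\<mu>"
    using K_finite by (simp add: emeasure_eq_ennreal_measure)
  have "ennreal (LINT w:K|lborel. a / norm (z - w)) = (\<integral>\<^sup>+w. ennreal (indicator K w *\<^sub>R (a / norm (z - w))) \<partial>lborel)"
    unfolding set_lebesgue_integral_def
    using inverse_norm_integrable[of a z] a unfolding set_integrable_def
    by (intro nn_integral_eq_integral[symmetric]) (auto simp: indicator_def)
  also have "\<dots> = (\<integral>\<^sup>+w\<in>K. ennreal (a / norm (z - w)) \<partial>lborel)"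
    by (intro nn_integral_cong) (auto simp: indicator_def)
  also have "\<dots> \<le> emeasure lborel K + ennreal (2 * pi * a\<^sup>2)"
    using a by (intro nn_integral_inverse_norm_le K_sets) auto
  also have "\<dots> = ennreal (?\<mu> + 2 * pi * ?\<mu>)"
    using pos by (simp add: emeasure_K a flip: ennreal_plus)
  finally have inv_le: "(LINT w:K|lborel. a / norm (z - w)) \<le> ?\<mu> + 2 * pi * ?\<mu>"
    by (subst (asm) ennreal_le_iff) (use pos in auto)
  have const: "set_integrable lborel K (\<lambda>w. - ln a - 1)"
    unfolding set_integrable_def by (intro borel_integrable_compact K continuous_intros)
  have "log_potential K z = (LINT w:K|lborel. - ln (norm (z - w)))"
    by (simp add: log_potential_def set_lebesgue_integral_def)
  also have "\<dots> \<le> (LINT w:K|lborel. (- ln a - 1) + a / norm (z - w))"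
  proof (rule set_integral_mono_AE)
    show "set_integrable lborel K (\<lambda>w. - ln (norm (z - w)))"
      using ln_norm_integrable[of z] by (simp add: set_integrable_def)
    show "set_integrable lborel K (\<lambda>w. (- ln a - 1) + a / norm (z - w))"
      using const inverse_norm_integrable[of a z] a by (intro set_integral_add) auto
    \<comment> \<open>The inequality may fail at \<open>w = z\<close>, where the logarithm has the default value \<open>0\<close>.\<close>
    show "AE w\<in>K in lborel. - ln (norm (z - w)) \<le> (- ln a - 1) + a / norm (z - w)"
      using AE_lborel_singleton[of z]
    proof eventually_elim
      case (elim w)
      then have "norm (z - w) > 0" by simp
      then show ?case
        using ln_le_minus_one[of "a / norm (z - w)"] a by (simp add: ln_div)
    qed
  qed
  also have "\<dots> = (LINT w:K|lborel. - ln a - 1) + (LINT w:K|lborel. a / norm (z - w))"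
    using const inverse_norm_integrable[of a z] a by (intro set_integral_add) auto
  also have "\<dots> \<le> ?\<mu> * (- ln a - 1) + (?\<mu> + 2 * pi * ?\<mu>)"
    using inv_le by (simp add: set_lebesgue_integral_def)
  also have "\<dots> = ?\<mu> * (2 * pi - ln ?\<mu> / 2)"
    using pos by (simp add: a_def ln_sqrt algebra_simps)
  finally show ?thesis .
qed

lemma log_potential_0_nonneg:
  assumes "K \<subseteq> ball 0 1"
  shows "0 \<le> log_potential K 0"
proof -
  have "(LINT w:K|lborel. ln (norm (0 - w))) \<le> (LINT w:K|lborel. 0)"
  proof (rule set_integral_mono)
    show "set_integrable lborel K (\<lambda>w. 0 :: real)" by (simp add: set_integrable_def)
    show "ln (norm (0 - w)) \<le> 0" if "w \<in> K" for w
      using assms that by (cases "w = 0") auto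
  qed (rule ln_norm_integrable)
  then show ?thesis by (simp add: log_potential_def)
qed

lemma log_potential_le_on_circle:
  assumes "K \<subseteq> ball 0 1" "T > 1" "norm z = T"
  shows "log_potential K z \<le> - measure lborel K * ln (T - 1)"
proof -
  have "(LINT w:K|lborel. ln (T - 1)) \<le> (LINT w:K|lborel. ln (norm (z - w)))"
  proof (rule set_integral_mono)
    show "set_integrable lborel K (\<lambda>w. ln (T - 1))"
      unfolding set_integrable_def by (intro borel_integrable_compact K continuous_intros)
    show "ln (T - 1) \<le> ln (norm (z - w))" if "w \<in> K" for w
    proof -
      have "norm w < 1" using assms(1) that by auto
      then have "T - 1 \<le> norm (z - w)" using assms norm_triangle_ineq2[of z w] by simp
      moreover from this have "0 < norm (z - w)" using assms(2) by linarith
      ultimately show ?thesis using assms(2) by (subst ln_le_cancel_iff) auto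
    qed
  qed (rule ln_norm_integrable)
  then show ?thesis
    by (simp add: log_potential_def set_lebesgue_integral_def)
qed

text \<open>
  At distance \<open>d\<close> from \<open>K\<close> the potential is locally Lipschitz with constant \<open>2 area(K) / d\<close>,
  because the logarithm has this property away from \<open>0\<close>.
\<close>
lemma continuous_on_log_potential: "continuous_on (- K) (log_potential K)"
proof (cases "K = {}")
  case True
  then show ?thesis by (simp add: log_potential_def set_lebesgue_integral_def)
next
  case False
  show ?thesis
  proof (rule continuous_at_imp_continuous_on, rule ballI)
    fix z assume "z \<in> - K"
    define d where "d = infdist z K"
    have "d > 0" using \<open>z \<in> - K\<close> False K
      by (simp add: d_def infdist_pos_not_in_closed compact_imp_closed)
    have dist_K: "d \<le> norm (z - w)" if "w \<in> K" for w
      using infdist_le[OF that, of z] by (simp add: d_def dist_norm)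
    let ?C = "2 / d * measure lborel K"
    have lip: "\<bar>log_potential K y - log_potential K z\<bar> \<le> ?C * norm (y - z)" if y: "norm (y - z) < d / 2" for y
    proof -
      have diff: "\<bar>ln (norm (y - w)) - ln (norm (z - w))\<bar> \<le> 2 / d * norm (y - z)" if "w \<in> K" for w
      proof -
        have *: "ln p - ln q \<le> 2 / d * \<bar>p - q\<bar>" if "p \<ge> d / 2" "q \<ge> d / 2" for p q :: real
        proof -
          have "ln p - ln q = ln (p / q)" using that \<open>d > 0\<close> by (simp add: ln_div)
          also have "\<dots> \<le> p / q - 1" using that \<open>d > 0\<close> by (intro ln_le_minus_one) auto
          also have "\<dots> = (p - q) / q" using that \<open>d > 0\<close> by (simp add: diff_divide_distrib)
          also have "\<dots> \<le> \<bar>p - q\<bar> / (d / 2)" using that \<open>d > 0\<close> by (intro frac_le) auto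
          finally show ?thesis by (simp add: field_simps)
        qed
        have z: "norm (z - w) \<ge> d / 2" using dist_K[OF that] \<open>d > 0\<close> by simp
        have "norm (z - w) \<le> norm (z - y) + norm (y - w)" using norm_triangle_ineq[of "z - y" "y - w"] by simp
        then have yw: "norm (y - w) \<ge> d / 2" using dist_K[OF that] y by (simp add: norm_minus_commute)
        have "\<bar>norm (y - w) - norm (z - w)\<bar> \<le> norm (y - z)"
          using norm_triangle_ineq3[of "y - w" "z - w"] by simp
        then have "2 / d * \<bar>norm (y - w) - norm (z - w)\<bar> \<le> 2 / d * norm (y - z)"
          using \<open>d > 0\<close> by (intro mult_left_mono) auto
        moreover have "2 / d * \<bar>norm (z - w) - norm (y - w)\<bar> = 2 / d * \<bar>norm (y - w) - norm (z - w)\<bar>"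
          by (simp add: abs_minus_commute)
        ultimately show ?thesis using *[OF z yw] *[OF yw z] by linarith
      qed
      have "log_potential K y - log_potential K z = - (LINT w:K|lborel. ln (norm (y - w)) - ln (norm (z - w)))"
        unfolding log_potential_def by (subst set_integral_diff[OF ln_norm_integrable ln_norm_integrable]) simp
      also have "\<bar>\<dots>\<bar> \<le> (LINT w:K|lborel. \<bar>ln (norm (y - w)) - ln (norm (z - w))\<bar>)"
        using set_integral_norm_bound[OF set_integral_diff(1)[OF ln_norm_integrable[of y] ln_norm_integrable[of z]]]
        by simp
      also have "\<dots> \<le> (LINT w:K|lborel. 2 / d * norm (y - z))"
      proof (rule set_integral_mono)
        show "set_integrable lborel K (\<lambda>w. \<bar>ln (norm (y - w)) - ln (norm (z - w))\<bar>)"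
          by (intro set_integrable_abs set_integral_diff ln_norm_integrable)
        show "set_integrable lborel K (\<lambda>w. 2 / d * norm (y - z))"
          unfolding set_integrable_def by (intro borel_integrable_compact K continuous_intros)
      qed (rule diff)
      also have "\<dots> = ?C * norm (y - z)" by (simp add: set_lebesgue_integral_def)
      finally show ?thesis .
    qed
    have "((\<lambda>y. log_potential K y - log_potential K z) \<longlongrightarrow> 0) (at z)"
    proof (rule Lim_null_comparison)
      show "\<forall>\<^sub>F y in at z. norm (log_potential K y - log_potential K z) \<le> ?C * norm (y - z)"
        unfolding eventually_at using lip \<open>d > 0\<close>
        by (intro exI[of _ "d / 2"]) (auto simp: dist_norm)
      show "((\<lambda>y. ?C * norm (y - z)) \<longlongrightarrow> 0) (at z)"
        by (rule tendsto_eq_intros refl | simp)+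
    qed
    then show "isCont (log_potential K) z" by (simp add: isCont_def LIM_zero_iff)
  qed
qed

text \<open>
  The potential is an integral of the functions of lemma \<open>ln_norm_circle_mean\<close>, so that its mean
  value property off \<open>K\<close> follows from Fubini's theorem.
\<close>
lemma log_potential_circle_mean:
  assumes r: "r > 0" and disj: "cball a r \<inter> K = {}"
  shows "((\<lambda>\<theta>. log_potential K (a + of_real r * cis \<theta>)) has_integral 2 * pi * log_potential K a) {0..2*pi}"
proof -
  let ?S = "{0..2*pi}"
  let ?F = "\<lambda>\<theta> w. indicator ?S \<theta> * (indicator K w * ln (norm (a + of_real r * cis \<theta> - w)))"
  have circ: "a + of_real r * cis \<theta> \<in> - K" for \<theta>
    using r disj by (auto simp: dist_norm norm_mult disjoint_iff)
  have "integrable lborel (\<lambda>x. indicator (?S \<times> K) x *\<^sub>R ln (norm (a + of_real r * cis (fst x) - snd x)))"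
  proof (intro borel_integrable_compact compact_Times compact_Icc K continuous_intros)
    show "\<forall>x\<in>?S \<times> K. norm (a + of_real r * cis (fst x) - snd x) \<noteq> 0"
      using circ by fastforce
  qed
  also have "(\<lambda>x. indicator (?S \<times> K) x *\<^sub>R ln (norm (a + of_real r * cis (fst x) - snd x))) = case_prod ?F"
    by (auto simp: indicator_def fun_eq_iff)
  finally have int: "integrable (lborel \<Otimes>\<^sub>M lborel) (case_prod ?F)"
    by (simp add: lborel_prod)
  have cont: "continuous_on ?S (\<lambda>\<theta>. log_potential K (a + of_real r * cis \<theta>))"
    by (intro continuous_on_compose2[OF continuous_on_log_potential] continuous_intros) (use circ in auto)
  have inner: "(LINT \<theta>|lborel. ?F \<theta> w) = indicator K w * (2 * pi * ln (norm (a - w)))" for w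
  proof (cases "w \<in> K")
    case True
    then have w: "w \<notin> cball a r" using disj by auto
    have "continuous_on ?S (\<lambda>\<theta>. ln (norm (a + of_real r * cis \<theta> - w)))"
      by (intro continuous_intros) (use circ True in force)
    then have "set_integrable lborel ?S (\<lambda>\<theta>. ln (norm (a + of_real r * cis \<theta> - w)))"
      unfolding set_integrable_def by (intro borel_integrable_compact compact_Icc)
    then have "(LINT \<theta>:?S|lborel. ln (norm (a + of_real r * cis \<theta> - w))) = 2 * pi * ln (norm (a - w))"
      using ln_norm_circle_mean[OF r w] by (simp add: set_borel_integral_eq_integral integral_unique)
    then show ?thesis using True by (simp add: set_lebesgue_integral_def)
  qed simp
  have "integral ?S (\<lambda>\<theta>. log_potential K (a + of_real r * cis \<theta>))
      = (LINT \<theta>:?S|lborel. log_potential K (a + of_real r * cis \<theta>))"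
    using borel_integrable_compact[OF compact_Icc cont]
    by (intro set_borel_integral_eq_integral(2)[symmetric]) (simp add: set_integrable_def)
  also have "\<dots> = - (LINT \<theta>|lborel. (LINT w|lborel. ?F \<theta> w))"
    by (simp add: log_potential_def set_lebesgue_integral_def)
  also have "(LINT \<theta>|lborel. (LINT w|lborel. ?F \<theta> w)) = (LINT w|lborel. (LINT \<theta>|lborel. ?F \<theta> w))"
    using lborel_pair.Fubini_integral[OF int] by simp
  also have "\<dots> = (LINT w|lborel. 2 * pi * (indicator K w * ln (norm (a - w))))"
    unfolding inner by (simp add: mult_ac)
  also have "- \<dots> = 2 * pi * log_potential K a"
    by (simp add: log_potential_def set_lebesgue_integral_def)
  finally show ?thesis
    using integrable_continuous_interval[OF cont] by (simp add: has_integral_iff)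
qed

end

text \<open>
  Let \<open>L = ln (T - 1)\<close>, let \<open>p\<close> be the potential of a compact subset \<open>K\<close> of the sublevel set
  divided by the area \<open>\<mu>\<close> of \<open>K\<close>, and let \<open>S = L + 2\<pi> - ln \<mu> / 2\<close>, an upper bound of \<open>p + L\<close>.
  The function \<open>u - M + (s/S) (p + L)\<close> is at most \<open>0\<close> on the sublevel set because \<open>u \<le> M - s\<close>
  there, and on the circle of radius \<open>T\<close> because \<open>p \<le> - L\<close> there. By the maximum principle it is
  at most \<open>0\<close> at the origin, where \<open>p \<ge> 0\<close>. So \<open>s L / S \<le> A\<close>, which is an upper bound for \<open>ln
  \<mu>\<close>. The quotient \<open>A / L\<close> plays the part of the Riesz mass of \<open>u\<close> in the unit disc.
\<close>
lemma subharmonic_sublevel_area_le: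
  assumes u: "subharmonic_on V u" "cball 0 T \<subseteq> V" and T: "T > 2"
    and le: "\<And>z. z \<in> cball 0 T \<Longrightarrow> u z \<le> ereal M"
    and ge: "ereal (M - A) \<le> u 0" and A: "A > 0" and s: "s \<ge> 0"
  shows "emeasure lborel {z \<in> ball 0 1. u z < ereal (M - s)}
    \<le> ennreal (exp (2 * (ln (T - 1) + 2 * pi) - 2 * s * ln (T - 1) / A))"
    (is "emeasure _ ?W \<le> ennreal ?b")
proof -
  let ?L = "ln (T - 1)"
  have L: "?L > 0" using T by simp
  have ball_V: "ball 0 1 \<subseteq> V" using u(2) T by (auto intro!: subsetD[OF u(2)])
  have usc: "upper_semicontinuous_on V u" using u(1) by (simp add: subharmonic_on_def)
  have "open ?W"
    by (rule open_sublevel_if_upper_semicontinuous[OF usc open_ball ball_V])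
  \<comment> \<open>The estimate is proved for compact subsets, which have the open sublevel set as the
    neighbourhood that the maximum principle needs. Inner regularity then gives it for the sublevel set.\<close>
  have compact_le: "emeasure lborel K \<le> ennreal ?b" if K: "compact K" "K \<subseteq> ?W" for K
  proof (cases "measure lborel K = 0")
    case True
    then show ?thesis using emeasure_compact_finite[OF K(1)] by (simp add: emeasure_eq_ennreal_measure)
  next
    case False
    let ?\<mu> = "measure lborel K"
    have \<mu>: "?\<mu> > 0" using False by (simp add: zero_less_measure_iff)
    have "?\<mu> \<le> measure lborel (ball (0::complex) 1)"
      using K emeasure_lborel_ball_finite[of "0::complex" 1]
      by (intro measure_mono_fmeasurable) (auto simp: fmeasurable_def borel_compact)
    also have "\<dots> = pi" by (simp add: content_ball unit_ball_vol_2)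
    finally have "ln ?\<mu> \<le> ln pi" using \<mu> by simp
    also have "\<dots> \<le> pi - 1" by (intro ln_le_minus_one) simp
    finally have ln_\<mu>: "ln ?\<mu> \<le> pi - 1" .
    have K_disc: "K \<subseteq> ball 0 1" using K(2) by auto
    define S where "S = ?L + 2 * pi - ln ?\<mu> / 2"
    have S: "S > 0" using ln_\<mu> L pi_gt_zero unfolding S_def by linarith
    define g where "g z = s / S * (log_potential K z / ?\<mu> + ?L) - M" for z
    have "u 0 + ereal (g 0) \<le> 0"
    proof (rule subharmonic_maximum_principle[OF u])
      show "T > 0" "(0::complex) \<in> cball 0 T" using T by auto
      show "closed K" "open ?W" "K \<subseteq> ?W" using K \<open>open ?W\<close> by (auto intro: compact_imp_closed)
      show "continuous_on (- K) g"
        unfolding g_def by (intro continuous_intros continuous_on_log_potential K) (use \<mu> in auto)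
      show "((\<lambda>\<theta>. g (a + of_real r * cis \<theta>)) has_integral 2 * pi * g a) {0..2*pi}"
        if "r > 0" "cball a r \<inter> K = {}" for a r
      proof -
        have "((\<lambda>\<theta>. s / S / ?\<mu> * log_potential K (a + of_real r * cis \<theta>) + (s / S * ?L - M)) has_integral
            s / S / ?\<mu> * (2 * pi * log_potential K a) + 2 * pi * (s / S * ?L - M)) {0..2*pi}"
          using has_integral_const_real[of "s / S * ?L - M" 0 "2*pi"]
          by (intro has_integral_add has_integral_mult_right log_potential_circle_mean[OF K(1) that]) simp
        then show ?thesis
          by (rule has_integral_eq_rhs[OF has_integral_eq[rotated]]) (simp_all add: g_def algebra_simps)
      qed
      fix z :: complex assume z: "z \<in> cball 0 T" "z \<in> ?W \<or> norm z = T"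
      show "u z + ereal (g z) \<le> 0"
      proof (cases "z \<in> ?W")
        case True
        have "log_potential K z / ?\<mu> + ?L \<le> S"
          using log_potential_le[OF K(1) \<mu>, of z] \<mu> by (simp add: S_def field_simps)
        then have "s / S * (log_potential K z / ?\<mu> + ?L) \<le> s / S * S"
          using s S by (intro mult_left_mono) auto
        then have "g z \<le> s - M" using S by (simp add: g_def)
        then have "u z + ereal (g z) \<le> ereal (M - s) + ereal (s - M)"
          using True by (intro add_mono) auto
        then show ?thesis by (simp add: zero_ereal_def)
      next
        case False
        then have "log_potential K z \<le> - ?\<mu> * ?L"
          using z K(1) K_disc T by (intro log_potential_le_on_circle) auto
        then have "log_potential K z / ?\<mu> + ?L \<le> 0" using \<mu> by (simp add: field_simps)
        then have "g z \<le> - M" using s S by (simp add: g_def mult_le_0_iff divide_le_0_iff)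
        then have "u z + ereal (g z) \<le> ereal M + ereal (- M)"
          using le[OF z(1)] by (intro add_mono) auto
        then show ?thesis by (simp add: zero_ereal_def)
      qed
    qed
    then have "ereal (M - A) + ereal (g 0) \<le> 0"
      by (rule order_trans[OF add_right_mono[OF ge]])
    then have "g 0 \<le> A - M" by simp
    moreover have "s / S * ?L \<le> s / S * (log_potential K 0 / ?\<mu> + ?L)"
      using log_potential_0_nonneg[OF K(1) K_disc] \<mu> s S by (intro mult_left_mono) auto
    ultimately have "s / S * ?L \<le> A" by (simp add: g_def)
    then have "s * ?L / A \<le> S" using S A by (simp add: field_simps)
    then have "ln ?\<mu> \<le> 2 * (?L + 2 * pi) - 2 * s * ?L / A" by (simp add: S_def)
    then have "exp (ln ?\<mu>) \<le> ?b" by (subst exp_le_cancel_iff)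
    then have "?\<mu> \<le> ?b" using \<mu> by simp
    then show ?thesis
      using emeasure_compact_finite[OF K(1)] by (simp add: emeasure_eq_ennreal_measure ennreal_leI)
  qed
  show ?thesis
  proof (rule ennreal_le_epsilon)
    fix e :: real assume "e > 0"
    have "?W \<in> sets lebesgue" using \<open>open ?W\<close> by auto
    then obtain K where K: "closed K" "K \<subseteq> ?W" "?W - K \<in> lmeasurable" "emeasure lebesgue (?W - K) < ennreal e"
      by (rule sets_lebesgue_inner_closed[OF _ \<open>e > 0\<close>])
    have "bounded K" using K(2) by (intro bounded_subset[OF bounded_ball[of 0 1]]) auto
    then have "compact K" using K by (simp add: compact_eq_bounded_closed)
    have "emeasure lborel ?W \<le> emeasure lborel K + emeasure lborel (?W - K)"
      using K \<open>open ?W\<close> emeasure_subadditive[of K lborel "?W - K"] by (simp add: Un_absorb1)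
    also have "\<dots> \<le> ennreal ?b + ennreal e"
      using K \<open>open ?W\<close> compact_le[OF \<open>compact K\<close> K(2)]
      by (intro add_mono) (auto simp: emeasure_completion dest!: less_imp_le)
    finally show "emeasure lborel ?W \<le> ennreal ?b + ennreal e" .
  qed
qed

section \<open>Integrability near a point of small Lelong number\<close>

text \<open>
  Superlevel sets of the exponential are sublevel sets of the function: these are open by
  semicontinuity, and their size on complex lines is known from the area estimate.
\<close>
lemma less_exp_ereal_iff:
  assumes "c > 0" "l > 0"
  shows "ennreal l < exp_ereal (- (ereal (2 * c) * x)) \<longleftrightarrow> x < ereal (- ln l / (2 * c))"
proof (cases x)
  case (real r)
  have "l < exp (- (2 * c * r)) \<longleftrightarrow> ln l < - (2 * c * r)"
    using assms by (metis exp_less_cancel_iff exp_ln)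
  also have "\<dots> \<longleftrightarrow> r < - ln l / (2 * c)"
    using pos_less_divide_eq[of "2 * c" r "- ln l"] assms(1) by (auto simp: algebra_simps)
  finally show ?thesis
    using real assms by (simp add: exp_ereal_def ennreal_less_iff)
qed (use assms in \<open>simp_all add: exp_ereal_def\<close>)

lemma exp_ereal_borel_measurable:
  fixes \<phi> :: "'a::topological_space \<Rightarrow> ereal"
  assumes usc: "upper_semicontinuous_on \<Omega> \<phi>" and B: "open B" "B \<subseteq> \<Omega>"
    and fin: "\<And>z. z \<in> \<Omega> \<Longrightarrow> \<phi> z < \<infinity>" and c: "c > 0"
  shows "(\<lambda>z. exp_ereal (- (ereal (2 * c) * \<phi> z)) * indicator B z) \<in> borel_measurable borel"
    (is "?F \<in> _")
proof (rule borel_measurableI_greater)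
  fix y
  show "{z \<in> space borel. y < ?F z} \<in> sets borel"
  proof (cases y)
    case (real r)
    show ?thesis
    proof (cases "r = 0")
      case True
      have "0 < exp_ereal (- (ereal (2 * c) * \<phi> z))" if "z \<in> B" for z
        using fin[of z] that B c by (cases "\<phi> z") (auto simp: exp_ereal_def)
      then have "{z \<in> space borel. y < ?F z} = B"
        using real True by (auto simp: indicator_def)
      then show ?thesis using B by simp
    next
      case False
      then have "r > 0" using real by simp
      then have "{z \<in> space borel. y < ?F z} = {z\<in>B. \<phi> z < ereal (- ln r / (2 * c))}"
        using real less_exp_ereal_iff[OF c] by (auto simp: indicator_def split: if_splits)
      then show ?thesis using open_sublevel_if_upper_semicontinuous[OF usc B] by simp
    qed
  next
    case top
    have "{z \<in> space borel. y < ?F z} = {}" using top by auto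
    then show ?thesis by (simp only: sets.empty_sets)
  qed
qed

text \<open>
  The lines \<open>\<zeta> \<mapsto> p + \<zeta> w\<close> are taken through a point \<open>p\<close> with \<open>\<phi> p > \<nu> ln \<parallel>p\<parallel>\<close>, where \<open>\<nu>\<close> is
  chosen between the Lelong number and \<open>1/c\<close>. Let \<open>\<delta> = \<parallel>p\<parallel>\<close>. With \<open>\<parallel>w\<parallel> < 4 \<delta>\<close> the slices fill
  the ball of radius \<open>2 \<delta>\<close> around \<open>p\<close>, which contains the ball of radius \<open>\<delta>\<close> around \<open>0\<close>, and the
  parameter \<open>\<zeta>\<close> may run over the disc of radius \<open>T = (R - \<delta>) / (4 \<delta>)\<close> before a line leaves the
  ball of radius \<open>R\<close>. In the area estimate \<open>A = M - \<nu> ln \<delta>\<close> and \<open>L = ln (T - 1)\<close> is at least \<open>ln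
  (R/8) - ln \<delta>\<close>. Since \<open>c \<nu> < 1\<close>, this yields \<open>c A < L\<close> for small \<open>\<delta>\<close>. The weak-type exponent \<open>q
  = L / (c A)\<close> of the exponential on the slices is then larger than one, and it does not depend
  on the slice.
\<close>
lemma skoda_integrability:
  fixes \<phi> :: "complex^'n \<Rightarrow> ereal"
  assumes \<Omega>: "open \<Omega>" "0 \<in> \<Omega>" and psh: "plurisubharmonic_on \<Omega> \<phi>"
    and c: "c > 0" and lelong: "lelong_number \<phi> < ereal (1 / c)"
  obtains \<delta> where "\<delta> > 0" "ball 0 \<delta> \<subseteq> \<Omega>"
    "(\<integral>\<^sup>+z\<in>ball 0 \<delta>. exp_ereal (- (ereal (2 * c) * \<phi> z)) \<partial>lborel) < \<infinity>"
proof -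
  have usc: "upper_semicontinuous_on \<Omega> \<phi>" and fin: "\<And>z. z \<in> \<Omega> \<Longrightarrow> \<phi> z < \<infinity>"
    and sub: "\<And>a w. subharmonic_on {\<zeta>. a + \<zeta> *s w \<in> \<Omega>} (\<lambda>\<zeta>. \<phi> (a + \<zeta> *s w))"
    using psh by (auto simp: plurisubharmonic_on_def)
  have "max (lelong_number \<phi>) 0 < ereal (1 / c)" using lelong c by simp
  then obtain \<nu> where \<nu>: "max (lelong_number \<phi>) 0 < ereal \<nu>" "ereal \<nu> < ereal (1 / c)"
    using ereal_dense2 by blast
  then have \<nu>_pos: "\<nu> > 0" and c\<nu>: "c * \<nu> < 1" using c by (auto simp: field_simps)
  obtain M where M: "M \<ge> 0" "\<phi> 0 < ereal M"
  proof -
    have "max (\<phi> 0) 0 < \<infinity>" using fin[OF \<Omega>(2)] by (simp add: max_def)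
    then obtain M where "max (\<phi> 0) 0 < ereal M" using ereal_dense2 by blast
    then show ?thesis using that[of M] by simp
  qed
  obtain R where R: "R > 0" "cball 0 R \<subseteq> {z\<in>\<Omega>. \<phi> z < ereal M}"
    using open_sublevel_if_upper_semicontinuous[OF usc \<Omega>(1) order_refl, of "ereal M"] \<Omega> M
    unfolding open_contains_cball by blast
  \<comment> \<open>The bound on \<open>\<parallel>p\<parallel>\<close> that makes \<open>c A < L\<close> below.\<close>
  define \<delta>\<^sub>0 where "\<delta>\<^sub>0 = exp (- ((\<bar>c * M - ln (R / 8)\<bar> + 1) / (1 - c * \<nu>)))"
  define small where "small = min (R / 10) (min (1/2) \<delta>\<^sub>0)"
  have "small > 0" using R by (simp add: small_def \<delta>\<^sub>0_def)
  have "\<exists>p. p \<noteq> 0 \<and> norm p < small \<and> \<phi> p / log_norm p < ereal \<nu>"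
  proof (rule ccontr)
    assume "\<not> ?thesis"
    then have "\<forall>\<^sub>F p in at 0. ereal \<nu> \<le> \<phi> p / log_norm p"
      unfolding eventually_at using \<open>small > 0\<close> by (intro exI[of _ small]) (auto simp: not_less)
    then have "ereal \<nu> \<le> lelong_number \<phi>" unfolding lelong_number_def by (rule Liminf_bounded)
    with \<nu> show False by (simp add: not_less[symmetric])
  qed
  then obtain p where p: "p \<noteq> 0" "norm p < small" "\<phi> p / log_norm p < ereal \<nu>" by blast
  define \<delta> where "\<delta> = norm p"
  define l where "l = ln \<delta>"
  have \<delta>: "\<delta> > 0" "\<delta> < R / 10" "\<delta> < 1/2" "\<delta> < \<delta>\<^sub>0" using p by (auto simp: \<delta>_def small_def)
  have l: "l < 0" using \<delta> by (simp add: l_def)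
  have \<phi>_p: "ereal (\<nu> * l) \<le> \<phi> p"
  proof -
    have "\<phi> p / ereal l < ereal \<nu>" using p by (simp add: log_norm_def l_def \<delta>_def)
    then show ?thesis using l by (cases "\<phi> p") (auto simp: field_simps divide_ereal_def)
  qed
  have l_small: "c * M - ln (R / 8) < (1 - c * \<nu>) * (- l)"
  proof -
    have "ln \<delta> < ln \<delta>\<^sub>0" using \<delta> by simp
    then have "(\<bar>c * M - ln (R / 8)\<bar> + 1) / (1 - c * \<nu>) < - l"
      unfolding \<delta>\<^sub>0_def l_def by simp
    then have "\<bar>c * M - ln (R / 8)\<bar> + 1 < (1 - c * \<nu>) * (- l)"
      using c\<nu> by (simp add: pos_divide_less_eq mult.commute)
    then show ?thesis by linarith
  qed
  define T where "T = (R - \<delta>) / (4 * \<delta>)"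
  define L where "L = ln (T - 1)"
  define A where "A = M - \<nu> * l"
  have A: "A > 0" using M(1) mult_pos_neg[OF \<nu>_pos l] by (simp add: A_def)
  have T: "T > 2" using \<delta> by (simp add: T_def field_simps)
  have "R / (8 * \<delta>) \<le> T - 1" using \<delta> by (simp add: T_def field_simps)
  then have "ln (R / (8 * \<delta>)) \<le> L" unfolding L_def using R \<delta> T by (subst ln_le_cancel_iff) auto
  moreover have "ln (R / (8 * \<delta>)) = ln (R / 8) - l"
    using R \<delta> by (simp add: l_def ln_div ln_mult)
  ultimately have cA: "c * A < L"
    using l_small by (simp add: A_def algebra_simps)
  define q where "q = L / (c * A)"
  have q: "q > 1" using cA c A by (simp add: q_def)
  have L: "L > 0" using T by (simp add: L_def)
  define F where "F z = exp_ereal (- (ereal (2 * c) * \<phi> z)) * indicator (ball 0 R) z" for z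
  have R_\<Omega>: "ball 0 R \<subseteq> \<Omega>" using R ball_subset_cball[of "0::complex^'n" R] by blast
  have F [measurable]: "F \<in> borel_measurable borel"
    unfolding F_def by (intro exp_ereal_borel_measurable[OF usc _ R_\<Omega> fin c]) auto
  define B where "B = exp (2 * (L + 2 * pi))"
  let ?C = "emeasure lborel (ball (0::complex) 1) + ennreal (B / (1 - 2 powr (1 - q)))"
  have slice: "(\<integral>\<^sup>+\<zeta>\<in>ball 0 1. F (p + \<zeta> *s w) \<partial>lborel) \<le> ?C" if w: "norm w < 4 * \<delta>" for w
  proof (rule nn_integral_weak_type_le)
    have "(\<lambda>\<zeta>. p + \<zeta> *s w) \<in> borel_measurable borel"
      by (intro borel_measurable_continuous_onI continuous_intros)
    then show "(\<lambda>\<zeta>. F (p + \<zeta> *s w)) \<in> borel_measurable lborel"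
      using F by (simp add: measurable_compose)
    have norm_le: "norm (p + \<zeta> *s w) \<le> \<delta> + norm \<zeta> * (4 * \<delta>)" for \<zeta>
    proof -
      have "norm (p + \<zeta> *s w) \<le> \<delta> + norm \<zeta> * norm w"
        using norm_triangle_ineq[of p "\<zeta> *s w"] by (simp add: norm_vector_scalar_mult \<delta>_def)
      also have "\<dots> \<le> \<delta> + norm \<zeta> * (4 * \<delta>)"
        using w by (intro add_left_mono mult_left_mono) auto
      finally show ?thesis .
    qed
    have in_R: "p + \<zeta> *s w \<in> cball 0 R" if "\<zeta> \<in> cball 0 T" for \<zeta>
    proof -
      have "norm \<zeta> * (4 * \<delta>) \<le> T * (4 * \<delta>)" using that \<delta> by (intro mult_right_mono) auto
      also have "T * (4 * \<delta>) = R - \<delta>" using \<delta> by (simp add: T_def)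
      finally show ?thesis using norm_le[of \<zeta>] by simp
    qed
    fix k :: nat
    \<comment> \<open>With this \<open>s\<close>, the level \<open>2 ^ k\<close> of the exponential is the level \<open>M - s\<close> of \<open>\<phi>\<close>.\<close>
    define s where "s = M + ln (2 ^ k) / (2 * c)"
    have "s \<ge> 0" using M(1) c by (simp add: s_def)
    have eq: "M - s = - ln (2 ^ k) / (2 * c)" by (simp add: s_def)
    have "{\<zeta>\<in>ball 0 1. ennreal (2 ^ k) < F (p + \<zeta> *s w)} \<subseteq> {\<zeta>\<in>ball 0 1. \<phi> (p + \<zeta> *s w) < ereal (M - s)}"
      unfolding eq by (auto simp: F_def indicator_def less_exp_ereal_iff[OF c] split: if_splits)
    moreover have "open {\<zeta>\<in>ball 0 1. \<phi> (p + \<zeta> *s w) < ereal (M - s)}"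
    proof (rule open_sublevel_if_upper_semicontinuous)
      show "upper_semicontinuous_on {\<zeta>. p + \<zeta> *s w \<in> \<Omega>} (\<lambda>\<zeta>. \<phi> (p + \<zeta> *s w))"
        using sub[of p w] by (simp add: subharmonic_on_def)
      show "ball 0 1 \<subseteq> {\<zeta>. p + \<zeta> *s w \<in> \<Omega>}"
      proof
        fix \<zeta> :: complex assume "\<zeta> \<in> ball 0 1"
        then have "\<zeta> \<in> cball 0 T" using T by simp
        then show "\<zeta> \<in> {\<zeta>. p + \<zeta> *s w \<in> \<Omega>}" using in_R R by blast
      qed
    qed auto
    ultimately have "emeasure lborel {\<zeta>\<in>ball 0 1. ennreal (2 ^ k) < F (p + \<zeta> *s w)}
        \<le> emeasure lborel {\<zeta>\<in>ball 0 1. \<phi> (p + \<zeta> *s w) < ereal (M - s)}"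
      by (intro emeasure_mono) auto
    also have "\<dots> \<le> ennreal (exp (2 * (ln (T - 1) + 2 * pi) - 2 * s * ln (T - 1) / A))"
    proof (rule subharmonic_sublevel_area_le[OF sub _ T])
      show "cball 0 T \<subseteq> {\<zeta>. p + \<zeta> *s w \<in> \<Omega>}" using in_R R by blast
      show "\<phi> (p + \<zeta> *s w) \<le> ereal M" if "\<zeta> \<in> cball 0 T" for \<zeta>
        using in_R[OF that] R by (auto dest!: less_imp_le)
      show "ereal (M - A) \<le> \<phi> (p + 0 *s w)" using \<phi>_p by (simp add: A_def)
    qed fact+
    also have "\<dots> \<le> ennreal (B * (2 ^ k) powr (- q))"
    proof (rule ennreal_leI)
      have "2 * s * L / A = 2 * M * L / A + q * ln (2 ^ k)"
        using c A by (simp add: s_def q_def field_simps)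
      moreover have "2 * M * L / A \<ge> 0" using M(1) L A by simp
      ultimately have "2 * (L + 2 * pi) - 2 * s * L / A \<le> 2 * (L + 2 * pi) + - q * ln (2 ^ k)"
        by simp
      then have "exp (2 * (L + 2 * pi) - 2 * s * L / A) \<le> exp (2 * (L + 2 * pi) + - q * ln (2 ^ k))"
        by (subst exp_le_cancel_iff)
      also have "\<dots> = B * (2 ^ k) powr (- q)" by (simp only: exp_add B_def) (simp add: powr_def)
      finally show "exp (2 * (ln (T - 1) + 2 * pi) - 2 * s * ln (T - 1) / A) \<le> B * (2 ^ k) powr (- q)"
        by (simp only: L_def)
    qed
    finally show "emeasure lborel {\<zeta>\<in>ball 0 1. ennreal (2 ^ k) < F (p + \<zeta> *s w)} \<le> ennreal (B * (2 ^ k) powr (- q))" .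
  qed (use q in \<open>auto simp: B_def\<close>)
  have finite_p: "(\<integral>\<^sup>+v\<in>ball 0 (4 * \<delta> / 2). F (p + v) \<partial>lborel) < \<infinity>"
  proof (rule nn_integral_ball_le_complex_slices[where f = "\<lambda>v. F (p + v)" and C = ?C])
    show "?C < \<infinity>" using emeasure_lborel_ball_finite[of "0::complex" 1] by simp
  qed (use slice in auto)
  have "(\<integral>\<^sup>+z\<in>ball 0 \<delta>. exp_ereal (- (ereal (2 * c) * \<phi> z)) \<partial>lborel) = (\<integral>\<^sup>+z\<in>ball 0 \<delta>. F z \<partial>lborel)"
    using \<delta> by (intro nn_integral_cong) (auto simp: F_def indicator_def)
  also have "\<dots> = (\<integral>\<^sup>+v. F (p + v) * indicator (ball 0 \<delta>) (p + v) \<partial>lborel)"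
    by (rule nn_integral_lborel_translate[symmetric]) (intro borel_measurable_times_ennreal F borel_measurable_indicator, simp)
  also have "\<dots> \<le> (\<integral>\<^sup>+v\<in>ball 0 (4 * \<delta> / 2). F (p + v) \<partial>lborel)"
  proof (intro nn_integral_mono mult_left_mono)
    fix v
    have "norm v \<le> norm (p + v) + \<delta>" using norm_triangle_ineq4[of "p + v" p] by (simp add: \<delta>_def)
    then show "(indicator (ball 0 \<delta>) (p + v) :: ennreal) \<le> indicator (ball 0 (4 * \<delta> / 2)) v"
      by (auto simp: indicator_def)
  qed simp
  also note finite_p
  finally have "(\<integral>\<^sup>+z\<in>ball 0 \<delta>. exp_ereal (- (ereal (2 * c) * \<phi> z)) \<partial>lborel) < \<infinity>" .
  moreover have "ball 0 \<delta> \<subseteq> \<Omega>" using R_\<Omega> \<delta> by (auto intro!: subsetD[OF R_\<Omega>])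
  ultimately show ?thesis using that \<delta>(1) by blast
qed

section \<open>Bounds for the weighted threshold\<close>
lemma norm_powr_integrable_on_ball:
  assumes \<beta>: "\<beta> > - real DIM('a)"
  shows "(\<integral>\<^sup>+z\<in>ball (0::'a::euclidean_space) 1. ennreal (norm z powr \<beta>) \<partial>lborel) < \<infinity>"
proof (cases "\<beta> < 0")
  case False
  have "(\<integral>\<^sup>+z\<in>ball (0::'a) 1. ennreal (norm z powr \<beta>) \<partial>lborel) \<le> (\<integral>\<^sup>+z. indicator (ball (0::'a) 1) z \<partial>lborel)"
    using False by (intro nn_integral_mono) (auto simp: indicator_def powr_le1)
  also have "\<dots> < \<infinity>" using emeasure_lborel_ball_finite[of "0::'a" 1] by simp
  finally show ?thesis .
next
  case True
  let ?V = "unit_ball_vol (real DIM('a))"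
  define q where "q = - real DIM('a) / \<beta>"
  have q: "q > 1" using \<beta> True by (simp add: q_def field_simps)
  have "(\<integral>\<^sup>+z\<in>ball (0::'a) 1. ennreal (norm z powr \<beta>) \<partial>lborel)
      \<le> emeasure lborel (ball (0::'a) 1) + ennreal (?V / (1 - 2 powr (1 - q)))"
  proof (rule nn_integral_weak_type_le[OF _ _ q])
    fix k :: nat
    let ?r = "(2 ^ k) powr (1 / \<beta>) :: real"
    have "{z\<in>ball 0 1. ennreal (2 ^ k) < ennreal (norm z powr \<beta>)} \<subseteq> ball (0::'a) ?r"
    proof clarify
      fix z :: 'a assume "ennreal (2 ^ k) < ennreal (norm z powr \<beta>)"
      then have less: "2 ^ k < norm z powr \<beta>" by (simp add: ennreal_less_iff)
      then have "z \<noteq> 0" by auto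
      have "(norm z powr \<beta>) powr (1 / \<beta>) < (2 ^ k) powr (1 / \<beta>)"
        using less True by (intro powr_less_mono2_neg) auto
      then show "z \<in> ball 0 ?r" using True \<open>z \<noteq> 0\<close> by (simp add: powr_powr)
    qed
    then have "emeasure lborel {z\<in>ball (0::'a) 1. ennreal (2 ^ k) < ennreal (norm z powr \<beta>)} \<le> emeasure lborel (ball (0::'a) ?r)"
      by (intro emeasure_mono) auto
    also have "\<dots> = ennreal (?V * ?r ^ DIM('a))" by (rule emeasure_ball) simp
    also have "?r ^ DIM('a) = (2 ^ k) powr (- q)"
      by (simp add: q_def powr_powr flip: powr_realpow)
    finally show "emeasure lborel {z\<in>ball (0::'a) 1. ennreal (2 ^ k) < ennreal (norm z powr \<beta>)} \<le> ennreal (?V * (2 ^ k) powr (- q))" .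
  qed auto
  also have "\<dots> < \<infinity>" using emeasure_lborel_ball_finite[of "0::'a" 1] by simp
  finally show ?thesis .
qed

text \<open>
  A single small ball suffices: on the ball of radius \<open>r\<close> the integral is at least a constant
  times \<open>r\<close> to the negative power \<open>\<gamma> = \<beta> + DIM('a)\<close>, which is unbounded as \<open>r\<close> tends to \<open>0\<close>.
\<close>
lemma norm_powr_not_integrable_near_0:
  fixes U :: "'a::euclidean_space set"
  assumes \<beta>: "\<beta> < - real DIM('a)" and U: "open U" "0 \<in> U"
  shows "(\<integral>\<^sup>+z\<in>U. ennreal (norm z powr \<beta>) \<partial>lborel) = \<infinity>" (is "?I = _")
proof (rule ccontr)
  assume "?I \<noteq> \<infinity>"
  then obtain I where I: "?I = ennreal I" "I \<ge> 0" by (cases ?I) auto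
  let ?V = "unit_ball_vol (real DIM('a))"
  have V: "?V > 0" by simp
  obtain e where e: "e > 0" "ball 0 e \<subseteq> U" using U open_contains_ball by blast
  define \<gamma> where "\<gamma> = \<beta> + real DIM('a)"
  have \<gamma>: "\<gamma> < 0" using \<beta> by (simp add: \<gamma>_def)
  define X where "X = (I + 1) / ?V"
  have X: "X > 0" using I V by (simp add: X_def)
  define r where "r = min e (X powr (1 / \<gamma>))"
  have r: "r > 0" "r \<le> e" using e X by (auto simp: r_def)
  have "X = (X powr (1 / \<gamma>)) powr \<gamma>" using X \<gamma> by (simp add: powr_powr)
  also have "\<dots> \<le> r powr \<gamma>" using r \<gamma> by (intro powr_mono2') (auto simp: r_def)
  finally have rX: "X \<le> r powr \<gamma>" .
  have "ennreal (r powr \<beta>) * emeasure lborel (ball (0::'a) r - {0})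
      = (\<integral>\<^sup>+z\<in>ball (0::'a) r - {0}. ennreal (r powr \<beta>) \<partial>lborel)"
    by (subst nn_integral_cmult_indicator) auto
  also have "\<dots> \<le> ?I"
  proof (rule nn_integral_mono)
    fix z :: 'a
    show "ennreal (r powr \<beta>) * indicator (ball 0 r - {0}) z \<le> ennreal (norm z powr \<beta>) * indicator U z"
    proof (cases "z \<in> ball 0 r - {0}")
      case True
      moreover have "z \<in> U" using True r e by auto
      moreover have "r powr \<beta> \<le> norm z powr \<beta>" using True \<beta> r by (intro powr_mono2') auto
      ultimately show ?thesis by (simp add: ennreal_leI)
    qed simp
  qed
  also have "emeasure lborel (ball (0::'a) r - {0}) = ennreal (?V * r ^ DIM('a))"
    using r by (subst emeasure_Diff_null_set) (auto simp: emeasure_ball)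
  also have "ennreal (r powr \<beta>) * ennreal (?V * r ^ DIM('a)) = ennreal (?V * r powr \<gamma>)"
    using r by (simp add: \<gamma>_def powr_add powr_realpow mult_ac flip: ennreal_mult)
  finally have "?V * r powr \<gamma> \<le> I" using I by (simp add: ennreal_le_iff)
  moreover have "I + 1 \<le> ?V * r powr \<gamma>"
    using mult_left_mono[OF rX, of ?V] V by (simp add: X_def)
  ultimately show False by simp
qed

text \<open>
  Young's inequality \<open>x y \<le> x ^ (1 / (1 - \<eta>)) + y ^ (1 / \<eta>)\<close> separates the weight from the
  exponential, at the price of enlarging both exponents.
\<close>
lemma young_exp_ereal:
  fixes x :: ereal
  assumes c: "c > 0" and \<eta>: "0 < \<eta>" "\<eta> < 1"
  shows "ennreal (\<rho> powr t) * exp_ereal (- (ereal (2 * c) * x))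
    \<le> ennreal (\<rho> powr (t / (1 - \<eta>))) + exp_ereal (- (ereal (2 * (c / \<eta>)) * x))"
proof (cases x)
  case (real r)
  define a b where "a = \<rho> powr (t / (1 - \<eta>))" and "b = exp (- (2 * (c / \<eta>) * r))"
  have nonneg: "a \<ge> 0" "b > 0" by (auto simp: a_def b_def)
  have "\<rho> powr t * exp (- (2 * c * r)) = a powr (1 - \<eta>) * b powr \<eta>"
    using \<eta> by (simp add: a_def b_def powr_powr exp_powr_real)
  also have "\<dots> \<le> (max a b) powr (1 - \<eta>) * (max a b) powr \<eta>"
    using \<eta> nonneg by (intro mult_mono powr_mono2) auto
  also have "\<dots> = max a b" using nonneg by (simp add: max_def flip: powr_add)
  also have "\<dots> \<le> a + b" using nonneg by simp
  finally have "\<rho> powr t * exp (- (2 * c * r)) \<le> a + b" .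
  then show ?thesis
    using real nonneg by (simp add: exp_ereal_def a_def b_def ennreal_leI flip: ennreal_mult ennreal_plus)
next
  case MInf
  then show ?thesis using c \<eta> by (simp add: exp_ereal_def)
next
  case PInf
  then show ?thesis using c \<eta> by (simp add: exp_ereal_def)
qed

text \<open>
  After Young's inequality the exponential is integrable by Skoda's theorem, as the Lelong
  number is less than \<open>\<eta> / c\<close>. The enlarged weight \<open>\<parallel>z\<parallel> powr (2t / (1 - \<eta>))\<close> is integrable
  because its exponent exceeds \<open>-2n\<close>, which is the condition \<open>\<eta> < 1 + t/n\<close>.
\<close>
lemma weighted_integrable_if_lelong_small:
  fixes \<phi> :: "complex^'n \<Rightarrow> ereal"
  assumes \<Omega>: "open \<Omega>" "0 \<in> \<Omega>" and psh: "plurisubharmonic_on \<Omega> \<phi>"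
    and c: "c > 0" and \<eta>: "0 < \<eta>" "\<eta> < 1" "\<eta> < 1 + t / real CARD('n)"
    and lelong: "lelong_number \<phi> < ereal (\<eta> / c)"
  shows "weighted_integrable_near_0 t \<phi> c"
proof -
  have c\<eta>: "c / \<eta> > 0" using c \<eta> by simp
  obtain \<delta> where \<delta>: "\<delta> > 0" "ball 0 \<delta> \<subseteq> \<Omega>"
    "(\<integral>\<^sup>+z\<in>ball 0 \<delta>. exp_ereal (- (ereal (2 * (c / \<eta>)) * \<phi> z)) \<partial>lborel) < \<infinity>"
    using skoda_integrability[OF \<Omega> psh c\<eta>] lelong by auto
  let ?\<beta> = "2 * t / (1 - \<eta>)"
  let ?F = "\<lambda>z. exp_ereal (- (ereal (2 * (c / \<eta>)) * \<phi> z)) * indicator (ball 0 \<delta>) z"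
  have F: "?F \<in> borel_measurable borel"
    using psh c\<eta> \<delta>(2) by (intro exp_ereal_borel_measurable[of \<Omega>]) (auto simp: plurisubharmonic_on_def)
  have "- real CARD('n) * (1 - \<eta>) < t" using \<eta>(3) by (simp add: field_simps)
  then have \<beta>: "?\<beta> > - real DIM(complex^'n)" using \<eta>(2) by (simp add: field_simps)
  let ?U = "ball (0 :: complex^'n) (min 1 \<delta>)"
  have "(\<integral>\<^sup>+z\<in>?U. (ennreal (norm z powr (2*t)) * exp_ereal (- (ereal (2*c) * \<phi> z))) \<partial>lborel)
      \<le> (\<integral>\<^sup>+z. ennreal (norm z powr ?\<beta>) * indicator (ball 0 1) z + ?F z \<partial>lborel)"
  proof (rule nn_integral_mono)
    fix z :: "complex^'n"
    show "ennreal (norm z powr (2*t)) * exp_ereal (- (ereal (2*c) * \<phi> z)) * indicator ?U z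
        \<le> ennreal (norm z powr ?\<beta>) * indicator (ball 0 1) z + ?F z"
      using young_exp_ereal[OF c \<eta>(1,2), of "norm z" "2 * t" "\<phi> z"]
      by (cases "z \<in> ?U") auto
  qed
  also have "\<dots> = (\<integral>\<^sup>+z\<in>ball (0 :: complex^'n) 1. ennreal (norm z powr ?\<beta>) \<partial>lborel) + (\<integral>\<^sup>+z. ?F z \<partial>lborel)"
    
  proof (rule nn_integral_add)
    show "(\<lambda>z :: complex^'n. ennreal (norm z powr ?\<beta>) * indicator (ball 0 1) z) \<in> borel_measurable lborel"
      by (intro borel_measurable_times_ennreal borel_measurable_indicator) auto
    show "?F \<in> borel_measurable lborel" unfolding measurable_lborel2 by (rule F)
  qed
  also have "\<dots> < \<infinity>" using norm_powr_integrable_on_ball[OF \<beta>] \<delta>(3) by simp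
  finally show ?thesis unfolding weighted_integrable_near_0_def
    using \<delta>(1) by (intro exI[of _ ?U]) auto
qed

text \<open>
  Near \<open>0\<close> one has \<open>\<phi> \<le> \<nu> log \<parallel>z\<parallel>\<close>, so the integrand is bounded below by a power of the norm,
  which is integrable only if \<open>2t - 2c\<nu> \<ge> -2n\<close>.
\<close>
lemma weighted_integrable_imp_exponent_le:
  fixes \<phi> :: "complex^'n \<Rightarrow> ereal"
  assumes lelong: "ereal \<nu> < lelong_number \<phi>" and \<nu>: "\<nu> > 0" and c: "c \<ge> 0"
    and t: "t > - real CARD('n)" and int: "weighted_integrable_near_0 t \<phi> c"
  shows "c * \<nu> \<le> t + real CARD('n)"
proof (rule ccontr)
  assume "\<not> ?thesis"
  then have gt: "c * \<nu> > t + real CARD('n)" by simp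
  then have "c \<noteq> 0" using t by auto
  then have c: "c > 0" using c by simp
  obtain U where U: "open U" "0 \<in> U"
    "(\<integral>\<^sup>+z\<in>U. (ennreal (norm z powr (2*t)) * exp_ereal (- (ereal (2*c) * \<phi> z))) \<partial>lborel) < \<infinity>"
    using int unfolding weighted_integrable_near_0_def by blast
  have "\<forall>\<^sub>F z in at 0. ereal \<nu> < \<phi> z / log_norm z"
    using lelong unfolding lelong_number_def by (rule less_LiminfD)
  then obtain d where d: "d > 0" "\<And>z. z \<noteq> 0 \<Longrightarrow> norm z < d \<Longrightarrow> ereal \<nu> < \<phi> z / log_norm z"
    unfolding eventually_at by auto
  let ?\<beta> = "2 * t - 2 * c * \<nu>"
  let ?W = "U \<inter> ball 0 (min d 1)"
  have "(\<integral>\<^sup>+z\<in>?W. ennreal (norm z powr ?\<beta>) \<partial>lborel) = \<infinity>"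
    using gt U d by (intro norm_powr_not_integrable_near_0) auto
  moreover have "(\<integral>\<^sup>+z\<in>?W. ennreal (norm z powr ?\<beta>) \<partial>lborel)
      \<le> (\<integral>\<^sup>+z\<in>U. (ennreal (norm z powr (2*t)) * exp_ereal (- (ereal (2*c) * \<phi> z))) \<partial>lborel)"
  proof (rule nn_integral_mono)
    fix z :: "complex^'n"
    show "ennreal (norm z powr ?\<beta>) * indicator ?W z
        \<le> ennreal (norm z powr (2*t)) * exp_ereal (- (ereal (2*c) * \<phi> z)) * indicator U z"
    proof (cases "z \<in> ?W \<and> z \<noteq> 0")
      case True
      define l where "l = ln (norm z)"
      have l: "l < 0" using True by (simp add: l_def)
      have "ereal \<nu> < \<phi> z / ereal l" using d(2)[of z] True by (simp add: log_norm_def l_def)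
      then have "\<phi> z \<le> ereal (\<nu> * l)"
        using l by (cases "\<phi> z") (auto simp: field_simps)
      then have "ennreal (exp (- (2 * c * (\<nu> * l)))) \<le> exp_ereal (- (ereal (2*c) * \<phi> z))"
        using c by (cases "\<phi> z") (auto simp: exp_ereal_def intro!: ennreal_leI)
      then have "ennreal (norm z powr (2*t)) * ennreal (exp (- (2 * c * (\<nu> * l))))
          \<le> ennreal (norm z powr (2*t)) * exp_ereal (- (ereal (2*c) * \<phi> z))"
        by (intro mult_left_mono) auto
      moreover have "norm z powr ?\<beta> = norm z powr (2*t) * exp (- (2 * c * (\<nu> * l)))"
        using True by (simp add: powr_def l_def algebra_simps flip: exp_add)
      ultimately show ?thesis using True by (simp add: ennreal_mult)
    qed (auto simp: indicator_def)
  qed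
  ultimately show False using U(3) by simp
qed

lemma weighted_lct_ge:
  fixes \<phi> :: "complex^'n \<Rightarrow> ereal"
  assumes \<Omega>: "open \<Omega>" "0 \<in> \<Omega>" and psh: "plurisubharmonic_on \<Omega> \<phi>"
    and t: "t > - real CARD('n)" and \<nu>: "\<nu> > 0" "lelong_number \<phi> \<le> ereal \<nu>"
  shows "ereal (min 1 (1 + t / real CARD('n)) / \<nu>) \<le> weighted_lct t \<phi>"
proof (rule ccontr)
  let ?\<kappa> = "min 1 (1 + t / real CARD('n))"
  assume "\<not> ?thesis"
  moreover have "?\<kappa> > 0" using t by (simp add: field_simps)
  ultimately have "max (weighted_lct t \<phi>) 0 < ereal (?\<kappa> / \<nu>)" using \<nu> by simp
  then obtain c where c: "max (weighted_lct t \<phi>) 0 < ereal c" "ereal c < ereal (?\<kappa> / \<nu>)"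
    using ereal_dense2 by blast
  then have "c > 0" "c * \<nu> < ?\<kappa>" using \<nu> by (auto simp: pos_less_divide_eq)
  then obtain \<eta> where \<eta>: "c * \<nu> < \<eta>" "\<eta> < ?\<kappa>" using dense by blast
  have "c * \<nu> > 0" using \<open>c > 0\<close> \<nu> by simp
  have "\<nu> < \<eta> / c" using \<eta> \<open>c > 0\<close> by (simp add: field_simps)
  then have "weighted_integrable_near_0 t \<phi> c"
    using \<eta> \<open>c > 0\<close> \<open>c * \<nu> > 0\<close> le_less_trans[OF \<nu>(2)]
    by (intro weighted_integrable_if_lelong_small[OF \<Omega> psh, of c \<eta>]) auto
  then have "ereal c \<le> weighted_lct t \<phi>"
    unfolding weighted_lct_def using \<open>c > 0\<close> by (intro Sup_upper) auto
  with c show False by (simp add: not_less[symmetric])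
qed

lemma weighted_lct_nonneg:
  fixes \<phi> :: "complex^'n \<Rightarrow> ereal"
  assumes t: "t > - real CARD('n)"
  shows "0 \<le> weighted_lct t \<phi>"
proof -
  have "(\<integral>\<^sup>+z\<in>ball (0 :: complex^'n) 1. ennreal (norm z powr (2 * t)) \<partial>lborel) < \<infinity>"
    using t by (intro norm_powr_integrable_on_ball) simp
  moreover have "exp_ereal 0 = 1" by (simp add: exp_ereal_def zero_ereal_def)
  ultimately have "weighted_integrable_near_0 t \<phi> 0"
    unfolding weighted_integrable_near_0_def
    by (intro exI[of _ "ball 0 1"]) (simp flip: zero_ereal_def)
  then show ?thesis
    unfolding weighted_lct_def zero_ereal_def by (intro Sup_upper) auto
qed

lemma weighted_lct_le:
  fixes \<phi> :: "complex^'n \<Rightarrow> ereal"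
  assumes t: "t > - real CARD('n)" and pos: "0 < lelong_number \<phi>"
  shows "weighted_lct t \<phi> \<le> ereal (t + real CARD('n)) / lelong_number \<phi>"
  unfolding weighted_lct_def
proof (rule Sup_least, clarify)
  fix c assume c: "c \<ge> 0" and int: "weighted_integrable_near_0 t \<phi> c"
  let ?n = "real CARD('n)"
  have le: "c * \<nu> \<le> t + ?n" if "\<nu> > 0" "ereal \<nu> < lelong_number \<phi>" for \<nu>
    using weighted_integrable_imp_exponent_le[OF that(2,1) c t int] .
  show "ereal c \<le> ereal (t + ?n) / lelong_number \<phi>"
  proof (cases "lelong_number \<phi>")
    case (real \<nu>)
    then have "\<nu> > 0" using pos by simp
    have "c \<le> (t + ?n) / \<nu>"
    proof (rule ccontr)
      assume "\<not> ?thesis"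
      then have less: "t + ?n < c * \<nu>" using \<open>\<nu> > 0\<close> by (simp add: field_simps)
      then have "c > 0" using c t by (cases "c = 0") auto
      then have "(t + ?n) / c < \<nu>" using less by (simp add: field_simps)
      then obtain \<nu>' where \<nu>': "(t + ?n) / c < \<nu>'" "\<nu>' < \<nu>" using dense by blast
      moreover have "0 < (t + ?n) / c" using t \<open>c > 0\<close> by simp
      ultimately have "c * \<nu>' \<le> t + ?n" using real by (intro le) auto
      then show False using \<nu>'(1) \<open>c > 0\<close> by (simp add: field_simps)
    qed
    then show ?thesis using real \<open>\<nu> > 0\<close> by simp
  next
    case PInf
    have "c = 0"
    proof (rule ccontr)
      assume "c \<noteq> 0"
      then have "c * ((t + ?n + 1) / c) \<le> t + ?n" using c t PInf by (intro le) auto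
      then show False using \<open>c \<noteq> 0\<close> by simp
    qed
    then show ?thesis using PInf by simp
  qed (use pos in auto)
qed

text \<open>
  For \<open>0 < \<parallel>z\<parallel> < 1\<close> the quotient by \<open>log \<parallel>z\<parallel>\<close> grows by exactly \<open>a\<close>.
\<close>
lemma lelong_number_add_log_ge:
  fixes \<phi> :: "complex^'n \<Rightarrow> ereal"
  assumes "ereal \<nu> \<le> lelong_number \<phi>"
  shows "ereal (\<nu> + a) \<le> lelong_number (\<lambda>z. \<phi> z + ereal a * log_norm z)"
proof -
  have "ereal x + ereal a \<le> lelong_number (\<lambda>z. \<phi> z + ereal a * log_norm z)" if "x < \<nu>" for x
    unfolding lelong_number_def
  proof (rule Liminf_bounded)
    have "ereal x < lelong_number \<phi>" using that less_le_trans[OF _ assms, of "ereal x"] by simp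
    then have "\<forall>\<^sub>F z in at 0. ereal x < \<phi> z / log_norm z"
      unfolding lelong_number_def by (rule less_LiminfD)
    moreover have "\<forall>\<^sub>F z :: complex^'n in at 0. z \<noteq> 0 \<and> norm z < 1"
      unfolding eventually_at by (intro exI[of _ 1]) auto
    ultimately show "\<forall>\<^sub>F z in at 0. ereal x + ereal a \<le> (\<phi> z + ereal a * log_norm z) / log_norm z"
    proof eventually_elim
      case (elim z)
      define l where "l = ln (norm z)"
      have l: "l < 0" "log_norm z = ereal l" using elim by (auto simp: l_def log_norm_def)
      then show ?case using elim by (cases "\<phi> z") (auto simp: field_simps)
    qed
  qed
  then have *: "\<And>x. x < \<nu> \<Longrightarrow> ereal (x + a) \<le> lelong_number (\<lambda>z. \<phi> z + ereal a * log_norm z)" by simp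
  show ?thesis
  proof (rule ccontr)
    assume "\<not> ?thesis"
    then obtain y where y: "lelong_number (\<lambda>z. \<phi> z + ereal a * log_norm z) < ereal y" "ereal y < ereal (\<nu> + a)"
      using ereal_dense2 by (metis not_less)
    then have "ereal y \<le> lelong_number (\<lambda>z. \<phi> z + ereal a * log_norm z)" using *[of "y - a"] by simp
    with y show False by (simp add: not_less[symmetric])
  qed
qed

theorem theorem1p1:
  fixes \<Omega> :: "(complex^'n) set" and \<phi> :: "complex^'n \<Rightarrow> ereal" and t :: real
  assumes "open \<Omega>" and "connected \<Omega>" and "0 \<in> \<Omega>"
    and "t > - real CARD('n)"
    and "plurisubharmonic_on \<Omega> \<phi>"
  shows "(0 < lelong_number \<phi> \<and> lelong_number \<phi> < \<infinity> \<longleftrightarrow>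
            0 < weighted_lct t \<phi> \<and> weighted_lct t \<phi> < \<infinity>) \<and>
         (0 < lelong_number \<phi> \<longrightarrow>
            1 / lelong_number (\<lambda>z. \<phi> z + ereal (\<bar>t\<bar> - t) / weighted_lct t \<phi> * log_norm z)
              \<le> weighted_lct t \<phi> \<and>
            weighted_lct t \<phi> \<le> ereal (t + real CARD('n)) / lelong_number \<phi>)"
proof -
  let ?n = "real CARD('n)"
  let ?\<nu> = "lelong_number \<phi>" and ?c = "weighted_lct t \<phi>"
  define \<kappa> where "\<kappa> = min 1 (1 + t / ?n)"
  have \<kappa>: "\<kappa> > 0" using assms(4) by (simp add: \<kappa>_def field_simps)
  have lower: "ereal (\<kappa> / \<nu>) \<le> ?c" if "\<nu> > 0" "?\<nu> \<le> ereal \<nu>" for \<nu>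
    using weighted_lct_ge[OF assms(1,3,5,4) that] by (simp add: \<kappa>_def)
  have upper: "?c \<le> ereal (t + ?n) / ?\<nu>" if "0 < ?\<nu>"
    using weighted_lct_le[OF assms(4) that] .
  have lct_pos_finite: "0 < ?c \<and> ?c < \<infinity>" if \<nu>: "0 < ?\<nu>" "?\<nu> < \<infinity>"
  proof -
    obtain \<nu> where real: "?\<nu> = ereal \<nu>" "\<nu> > 0" using \<nu> by (cases ?\<nu>) auto
    have "ereal 0 < ereal (\<kappa> / \<nu>)" using \<kappa> real by simp
    also have "\<dots> \<le> ?c" using lower real by simp
    finally show ?thesis using upper \<nu> real by (auto simp: zero_ereal_def)
  qed
  \<comment> \<open>Every positive real number is then an upper bound of the Lelong number, so that the
    lower bound for \<open>?c\<close> becomes arbitrarily large.\<close>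
  have lct_infinite: "?c = \<infinity>" if "?\<nu> \<le> 0"
  proof (rule ccontr)
    assume "?c \<noteq> \<infinity>"
    moreover have "ereal \<kappa> \<le> ?c" using lower[of 1] that by (simp add: order_trans[OF that])
    ultimately obtain C where C: "?c = ereal C" "C > 0" using \<kappa> by (cases ?c) auto
    have "ereal (\<kappa> / (\<kappa> / (C + 1))) \<le> ?c"
      using C \<kappa> by (intro lower order_trans[OF that]) auto
    then show False using C \<kappa> by simp
  qed
  have lct_zero: "?c \<le> 0" if "?\<nu> = \<infinity>"
    using upper that by simp
  have iff: "0 < ?\<nu> \<and> ?\<nu> < \<infinity> \<longleftrightarrow> 0 < ?c \<and> ?c < \<infinity>"
  proof
    assume c: "0 < ?c \<and> ?c < \<infinity>"
    then have "\<not> ?\<nu> \<le> 0" using lct_infinite by auto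
    moreover have "?\<nu> \<noteq> \<infinity>" using lct_zero c by auto
    ultimately show "0 < ?\<nu> \<and> ?\<nu> < \<infinity>" by simp
  qed (use lct_pos_finite in blast)
  have "1 / lelong_number (\<lambda>z. \<phi> z + ereal (\<bar>t\<bar> - t) / ?c * log_norm z) \<le> ?c" (is "1 / ?\<nu>' \<le> _")
    if pos: "0 < ?\<nu>"
  proof (cases "?\<nu>" )
    case (real \<nu>)
    then have \<nu>: "\<nu> > 0" using pos by simp
    then obtain C where C: "?c = ereal C" "C > 0"
      using lct_pos_finite real by (cases ?c) auto
    have "ereal (\<bar>t\<bar> - t) / ?c = ereal ((\<bar>t\<bar> - t) / C)" using C by simp
    then have "ereal (\<nu> + (\<bar>t\<bar> - t) / C) \<le> ?\<nu>'"
      using lelong_number_add_log_ge[of \<nu> \<phi> "(\<bar>t\<bar> - t) / C"] real by simp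
    moreover have "1 / C \<le> \<nu> + (\<bar>t\<bar> - t) / C"
    proof -
      have "\<kappa> \<le> C * \<nu>" using lower[of \<nu>] real \<nu> C by (simp add: field_simps)
      moreover have "1 \<le> \<kappa> + (\<bar>t\<bar> - t)"
      proof (cases "t < 0")
        case True
        have "1 \<le> ?n" by (simp add: Suc_leI)
        then have "t \<le> t / ?n" using True by (simp add: field_simps)
        then show ?thesis using True by (simp add: \<kappa>_def min_def)
      qed (simp add: \<kappa>_def)
      ultimately show ?thesis using C by (simp add: field_simps)
    qed
    ultimately have "ereal (1 / C) \<le> ?\<nu>'" by (meson ereal_less_eq(3) order_trans)
    moreover have "1 / ereal r \<le> ereal C" if "1 / C \<le> r" for r
    proof -
      have "0 < r" using that C by (meson divide_pos_pos less_le_trans zero_less_one)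
      then have "1 / r \<le> C" using that C by (simp add: field_simps)
      then show ?thesis using \<open>0 < r\<close> by (simp add: one_ereal_def)
    qed
    ultimately show ?thesis using C by (cases ?\<nu>') auto
  next
    case PInf
    \<comment> \<open>Here the coefficient of the logarithm has denominator \<open>0\<close>. If \<open>t < 0\<close> the quotient is
      \<open>\<infinity>\<close>, and the modified function is \<open>-\<infinity>\<close> near \<open>0\<close>; otherwise it is \<open>0\<close>.\<close>
    then have "?c \<le> 0" using lct_zero by simp
    then have c0: "?c = 0" using weighted_lct_nonneg[OF assms(4), of \<phi>] by simp
    have "?\<nu>' = \<infinity>"
    proof (cases "t < 0")
      case True
      have fin: "\<phi> z < \<infinity>" if "z \<in> \<Omega>" for z
        using assms(5) that by (simp add: plurisubharmonic_on_def)
      have "\<infinity> \<le> ?\<nu>'"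
        unfolding lelong_number_def
      proof (rule Liminf_bounded)
        have "\<forall>\<^sub>F z in at 0. z \<in> \<Omega>"
          using assms(1,3) by (simp add: eventually_at_in_open')
        moreover have "\<forall>\<^sub>F z :: complex^'n in at 0. z \<noteq> 0 \<and> norm z < 1"
          unfolding eventually_at by (intro exI[of _ 1]) auto
        ultimately show "\<forall>\<^sub>F z in at 0. \<infinity> \<le> (\<phi> z + ereal (\<bar>t\<bar> - t) / ?c * log_norm z) / log_norm z"
        proof eventually_elim
          case (elim z)
          have "ereal (\<bar>t\<bar> - t) / ?c = \<infinity>"
            using True by (simp add: c0 divide_ereal_def)
          then have "ereal (\<bar>t\<bar> - t) / ?c * log_norm z = - \<infinity>"
            using elim by (simp add: log_norm_def)
          moreover have "\<phi> z + - \<infinity> = - \<infinity>" using fin elim by (cases "\<phi> z") auto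
          ultimately have "\<phi> z + ereal (\<bar>t\<bar> - t) / ?c * log_norm z = - \<infinity>" by (simp only:)
          then show ?case using elim by (simp only:) (simp add: log_norm_def)
        qed
      qed
      then show ?thesis by simp
    next
      case False
      then show ?thesis using PInf by (simp add: c0 flip: zero_ereal_def)
    qed
    then show ?thesis using c0 by simp
  qed (use pos in simp)
  then show ?thesis using iff upper by blast
qed

end
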